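(* Let $n\ge2$ be finite, let $\mathbf k=(k_2,k_3,k_4,k_5)$ be a feasible signed four-size profile on $n$ vertices, with phase cap $U=\alpha-2\ge2$, and let $Z=Z^{\mathrm{sgn}}_{\mathbf k}$ be its signed witness count in $G_n\sim G(n,1/2)$. Then $$\frac{\mathbb E Z^2}{(\mathbb E Z)^2}=\sum_{(M,j)}w_{\mathrm{hi}}(M,j)\,\mathcal A(M,j),$$ where the sum ranges over the finite family of feasible canonical high skeletons $(M,j)$.
   Context: Let $\alpha:=\lfloor 2\log_2 n-2\log_2\log_2 n+2\log_2(\mathrm e/2)+1\rfloor$, $U:=\alpha-2$, $R_0:=\lfloor U/2\rfloor$. A feasible four-size profile is a vector of nonnegative integers $(k_2,\dots,k_5)$ with $\sum_i(\alpha-i)k_i=n$ (and $k_i=0$ if $\alpha-i\le0$). $G_n$ is the random graph on $[n]$ with independent edges of probability $1/2$. $Z^{\mathrm{sgn}}_{\mathbf k}$ is the number of pairs consisting of an unordered partition of $[n]$ with exactly $k_i$ classes of size $\alpha-i$ and a mark "independent" or "complete" on each class, such that every class induces an edgeless, resp. complete, graph in $G_n$ according to its mark. Two sides, rows and columns, each have $k_i$ labeled slots of size $\alpha-i$; $s_a$, $t_b$ denote sizes of row slot $a$ and column slot $b$. A slot of size $s$ carries $s$ labeled stubs, so each side has $n$ stubs. A cell is a pair $(a,b)$ of a row and a column slot; for a cell $e=(a,b)$, $s_e=s_a$, $t_e=t_b$. A feasible (canonical) high skeleton is $(M,j)$ where $M$ is a set of cells no two sharing a slot (possibly empty) and $j=(j_e)_{e\in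 M}$ are integers with $R_0<j_e\le\min\{s_e,t_e\}$. With $J=\sum_{e\in M}j_e$, $(x)_r=x(x-1)\cdots(x-r+1)$, and $g(0)=g(1)=g(2)=1$, $g(x)=2^{\binom x2-1}$ for $x\ge3$, $$w_{\mathrm{hi}}(M,j):=\frac{\prod_{e\in M}(s_e)_{j_e}(t_e)_{j_e}}{(n)_J\prod_{e\in M}j_e!}\prod_{e\in M}g(j_e).$$ Residual model: the residual degrees are $d_a=s_a-\sum_{b:(a,b)\in M}j_{ab}$, $d'_b=t_b-\sum_{a:(a,b)\in M}j_{ab}$, both summing to $m_0=n-J$. Take a uniform perfect matching between $m_0$ row stubs ($d_a$ at slot $a$) and $m_0$ column stubs ($d'_b$ at slot $b$) (the empty matching if $m_0=0$); let $r'_{ab}$ be the number of matched pairs in cell $(a,b)$, and $\mathbb E_{\mathrm{res}}$ the expectation. $H_{\mathrm{res}}$ is the simple bipartite graph of cells with $r'_{ab}\ge2$. The event $\mathcal E(M,j)$ is $\{r'_{ab}=0\text{ for }(a,b)\in M,\ r'_{ab}\le R_0\text{ for }(a,b)\notin M\}$. For a graph $H$ without isolated vertices, $\beta(H)=|E(H)|-|V(H)|+c(H)$ with $c$ the number of components ($\beta(\varnothing)=0$). Finally $$\mathcal A(M,j):=\mathbb E_{\mathrm{res}}\Big[\Big(\prod_{a,b}g(r'_{ab})\Big)2^{\beta(M\cup H_{\mathrm{res}})}\mathbf 1_{\mathcal E(M,j)}\Big].$$ *)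

theory Defs
  imports "HOL-Probability.Probability" "HOL-Library.Disjoint_Sets"
begin

definition alpha :: "nat \<Rightarrow> int" where
  "alpha n = \<lfloor>2 * log 2 (real n) - 2 * log 2 (log 2 (real n)) + 2 * log 2 (exp 1 / 2) + 1\<rfloor>"

definition cap_U :: "nat \<Rightarrow> int" where
  "cap_U n = alpha n - 2"

definition R0 :: "nat \<Rightarrow> int" where
  "R0 n = \<lfloor>real_of_int (cap_U n) / 2\<rfloor>"

text \<open>A four-size profile is a function of which only the values at 2, 3, 4, 5 are used.\<close>

definition feasible_profile :: "nat \<Rightarrow> (nat \<Rightarrow> nat) \<Rightarrow> bool" where
  "feasible_profile n k \<longleftrightarrow>
     (\<Sum>i\<in>{2..5}. (alpha n - int i) * int (k i)) = int n \<and>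
     (\<forall>i\<in>{2..5}. alpha n - int i \<le> 0 \<longrightarrow> k i = 0)"


section \<open>The random graph and the signed witness count\<close>

definition all_edges :: "nat \<Rightarrow> nat set set" where
  "all_edges n = {e. e \<subseteq> {1..n} \<and> card e = 2}"

text \<open>A graph on \<open>{1..n}\<close> is given by the indicator function of its edge set.\<close>

definition random_graph :: "nat \<Rightarrow> (nat set \<Rightarrow> bool) pmf" where
  "random_graph n = Pi_pmf (all_edges n) False (\<lambda>_. bernoulli_pmf (1/2))"

datatype mark = Independent | Complete

text \<open>Marks are extensional functions on the set of classes, so that every signed partition
  is represented by exactly one pair.\<close>

definition signed_partitions :: "nat \<Rightarrow> (nat \<Rightarrow> nat) \<Rightarrow> (nat set set \<times> (nat set \<Rightarrow> mark)) set" where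
  "signed_partitions n k =
     {(P, \<sigma>). partition_on {1..n} P \<and>
        (\<forall>i\<in>{2..5}. card {C \<in> P. int (card C) = alpha n - int i} = k i) \<and>
        \<sigma> \<in> P \<rightarrow>\<^sub>E UNIV}"

definition edgeless_on :: "(nat set \<Rightarrow> bool) \<Rightarrow> nat set \<Rightarrow> bool" where
  "edgeless_on G C \<longleftrightarrow> (\<forall>u\<in>C. \<forall>v\<in>C. u \<noteq> v \<longrightarrow> \<not> G {u, v})"

definition complete_on :: "(nat set \<Rightarrow> bool) \<Rightarrow> nat set \<Rightarrow> bool" where
  "complete_on G C \<longleftrightarrow> (\<forall>u\<in>C. \<forall>v\<in>C. u \<noteq> v \<longrightarrow> G {u, v})"

definition Z_sgn :: "nat \<Rightarrow> (nat \<Rightarrow> nat) \<Rightarrow> (nat set \<Rightarrow> bool) \<Rightarrow> nat" where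
  "Z_sgn n k G =
     card {(P, \<sigma>) \<in> signed_partitions n k.
       \<forall>C\<in>P. (\<sigma> C = Independent \<longrightarrow> edgeless_on G C) \<and> (\<sigma> C = Complete \<longrightarrow> complete_on G C)}"

lemma finite_signed_partitions: "finite (signed_partitions n k)"
proof -
  have sub: "signed_partitions n k \<subseteq> Sigma (Pow (Pow {1..n})) (\<lambda>P. P \<rightarrow>\<^sub>E (UNIV :: mark set))"
    by (auto simp: signed_partitions_def partition_on_def)
  have "(UNIV :: mark set) = {Independent, Complete}"
    using mark.exhaust by auto
  then have "finite (UNIV :: mark set)"
    by (metis finite.emptyI finite.insertI)
  then have "finite (Sigma (Pow (Pow {1..n})) (\<lambda>P. P \<rightarrow>\<^sub>E (UNIV :: mark set)))"
    by (intro finite_SigmaI finite_PiE) (auto dest: finite_subset)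
  with sub show ?thesis
    by (rule finite_subset)
qed


section \<open>Slots, cells and high skeletons\<close>

text \<open>The slot \<open>(i, l)\<close> is the \<open>l\<close>-th slot of size \<open>alpha n - i\<close>.  Rows and columns use the
  same index set; a cell is a pair of a row slot and a column slot.\<close>

type_synonym slot = "nat \<times> nat"
type_synonym cell = "slot \<times> slot"

definition slots :: "(nat \<Rightarrow> nat) \<Rightarrow> slot set" where
  "slots k = Sigma {2..5} (\<lambda>i. {..<k i})"

definition slot_size :: "nat \<Rightarrow> slot \<Rightarrow> nat" where
  "slot_size n a = nat (alpha n - int (fst a))"

text \<open>The multiplicities are extensional functions on \<open>M\<close>, so that every skeleton is
  represented by exactly one pair \<open>(M, j)\<close>.\<close>

definition high_skeletons :: "nat \<Rightarrow> (nat \<Rightarrow> nat) \<Rightarrow> (cell set \<times> (cell \<Rightarrow> nat)) set" where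
  "high_skeletons n k =
     {(M, j). M \<subseteq> slots k \<times> slots k \<and>
        (\<forall>e\<in>M. \<forall>f\<in>M. e \<noteq> f \<longrightarrow> fst e \<noteq> fst f \<and> snd e \<noteq> snd f) \<and>
        j \<in> (\<Pi>\<^sub>E e\<in>M. {x. R0 n < int x \<and> x \<le> min (slot_size n (fst e)) (slot_size n (snd e))})}"

lemma finite_slots: "finite (slots k)"
  by (simp add: slots_def)

lemma finite_high_skeletons: "finite (high_skeletons n k)"
proof -
  let ?J = "\<lambda>M :: cell set. \<Pi>\<^sub>E e\<in>M.
    {x. R0 n < int x \<and> x \<le> min (slot_size n (fst e)) (slot_size n (snd e))}"
  have sub: "high_skeletons n k \<subseteq> Sigma (Pow (slots k \<times> slots k)) ?J"
    by (auto simp: high_skeletons_def)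
  have "finite (Sigma (Pow (slots k \<times> slots k)) ?J)"
  proof (intro finite_SigmaI finite_PiE)
    show "finite (Pow (slots k \<times> slots k))"
      by (simp add: finite_slots)
    show "finite M" if "M \<in> Pow (slots k \<times> slots k)" for M
      using that finite_slots by (auto intro: finite_subset)
    show "finite {x. R0 n < int x \<and> x \<le> min (slot_size n (fst e)) (slot_size n (snd e))}"
      for e :: cell
      by (rule finite_subset[of _ "{..slot_size n (fst e)}"]) auto
  qed
  with sub show ?thesis
    by (rule finite_subset)
qed

definition falling :: "nat \<Rightarrow> nat \<Rightarrow> real" where
  "falling x r = (\<Prod>i<r. real x - real i)"

definition g :: "nat \<Rightarrow> real" where
  "g x = (if x \<le> 2 then 1 else 2 ^ ((x choose 2) - 1))"

definition w_hi :: "nat \<Rightarrow> cell set \<Rightarrow> (cell \<Rightarrow> nat) \<Rightarrow> real" where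
  "w_hi n M j =
     (\<Prod>e\<in>M. falling (slot_size n (fst e)) (j e) * falling (slot_size n (snd e)) (j e)) /
     (falling n (\<Sum>e\<in>M. j e) * (\<Prod>e\<in>M. fact (j e))) *
     (\<Prod>e\<in>M. g (j e))"


section \<open>The residual model\<close>

text \<open>On high skeletons the truncated subtractions below are genuine: at most one cell of \<open>M\<close>
  meets a given slot, and its multiplicity is at most the size of the slot.\<close>

definition row_deg :: "nat \<Rightarrow> cell set \<Rightarrow> (cell \<Rightarrow> nat) \<Rightarrow> slot \<Rightarrow> nat" where
  "row_deg n M j a = slot_size n a - (\<Sum>b | (a, b) \<in> M. j (a, b))"

definition col_deg :: "nat \<Rightarrow> cell set \<Rightarrow> (cell \<Rightarrow> nat) \<Rightarrow> slot \<Rightarrow> nat" where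
  "col_deg n M j b = slot_size n b - (\<Sum>a | (a, b) \<in> M. j (a, b))"

text \<open>A stub is a pair of a slot and a label.\<close>

type_synonym stub = "slot \<times> nat"

definition row_stubs :: "nat \<Rightarrow> (nat \<Rightarrow> nat) \<Rightarrow> cell set \<Rightarrow> (cell \<Rightarrow> nat) \<Rightarrow> stub set" where
  "row_stubs n k M j = Sigma (slots k) (\<lambda>a. {..<row_deg n M j a})"

definition col_stubs :: "nat \<Rightarrow> (nat \<Rightarrow> nat) \<Rightarrow> cell set \<Rightarrow> (cell \<Rightarrow> nat) \<Rightarrow> stub set" where
  "col_stubs n k M j = Sigma (slots k) (\<lambda>b. {..<col_deg n M j b})"

definition perfect_matchings :: "'a set \<Rightarrow> 'b set \<Rightarrow> ('a \<times> 'b) set set" where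
  "perfect_matchings X Y =
     {F. F \<subseteq> X \<times> Y \<and> (\<forall>x\<in>X. \<exists>!y. (x, y) \<in> F) \<and> (\<forall>y\<in>Y. \<exists>!x. (x, y) \<in> F)}"

definition residual_matching ::
    "nat \<Rightarrow> (nat \<Rightarrow> nat) \<Rightarrow> cell set \<Rightarrow> (cell \<Rightarrow> nat) \<Rightarrow> (stub \<times> stub) set pmf" where
  "residual_matching n k M j =
     pmf_of_set (perfect_matchings (row_stubs n k M j) (col_stubs n k M j))"

definition cell_count :: "(stub \<times> stub) set \<Rightarrow> cell \<Rightarrow> nat" where
  "cell_count F e = card {(x, y) \<in> F. fst x = fst e \<and> fst y = snd e}"

definition H_res :: "(nat \<Rightarrow> nat) \<Rightarrow> (stub \<times> stub) set \<Rightarrow> cell set" where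
  "H_res k F = {e \<in> slots k \<times> slots k. cell_count F e \<ge> 2}"

definition event_E :: "nat \<Rightarrow> (nat \<Rightarrow> nat) \<Rightarrow> cell set \<Rightarrow> (stub \<times> stub) set set" where
  "event_E n k M =
     {F. \<forall>e\<in>slots k \<times> slots k.
        (e \<in> M \<longrightarrow> cell_count F e = 0) \<and> (e \<notin> M \<longrightarrow> int (cell_count F e) \<le> R0 n)}"

text \<open>A graph without isolated vertices is given by its set of edges; its vertex set is the
  union of the edges, and its components are the classes of the reachability relation.\<close>

definition num_components :: "'v set set \<Rightarrow> nat" where
  "num_components E = card (\<Union>E // {(u, v). {u, v} \<in> E}\<^sup>*)"

definition beta :: "'v set set \<Rightarrow> int" where
  "beta E = int (card E) - int (card (\<Union>E)) + int (num_components E)"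

text \<open>The sum type keeps a row slot apart from the column slot with the same index.\<close>

definition cell_graph :: "cell set \<Rightarrow> (slot + slot) set set" where
  "cell_graph S = (\<lambda>(a, b). {Inl a, Inr b}) ` S"

definition A_res :: "nat \<Rightarrow> (nat \<Rightarrow> nat) \<Rightarrow> cell set \<Rightarrow> (cell \<Rightarrow> nat) \<Rightarrow> real" where
  "A_res n k M j =
     measure_pmf.expectation (residual_matching n k M j)
       (\<lambda>F. (\<Prod>e\<in>slots k \<times> slots k. g (cell_count F e)) *
             2 powi beta (cell_graph (M \<union> H_res k F)) *
             indicator (event_E n k M) F)"

end

theory Submission
  imports Defs
begin

text \<open>
  Label the vertices by the stubs of one side.  All partitions with the given profile have the
  same number of labelings, so both moments are averages over labelings.  For a pair of
  labelings the marks have to agree on any two classes sharing at least two vertices; counting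
  the compatible marks by connected components and the common edges by overlaps turns the
  contribution of the pair, relative to the squared first moment, into
  \<open>\<Prod> g(r\<^sub>a\<^sub>b) 2\<^sup>\<beta>\<close>, which only depends on the overlaps \<open>r\<close>.  A pair of labelings amounts to a
  perfect matching of row and column stubs, so the ratio is the mean of this weight under a
  uniform perfect matching.  Finally, group the matchings by their cells with more than
  \<open>R\<^sub>0\<close> pairs.  Two such cells in one slot would need more than \<open>U\<close> stubs, so they form a
  skeleton; the matched pairs inside the skeleton can be chosen in
  \<open>\<Prod> (s)\<^sub>j (t)\<^sub>j / j!\<close> ways, and the rest is a perfect matching of the residual stubs.
\<close>

section \<open>Matchings\<close>

text \<open>The exponent beta is a balance of powers of 2. For a pair of labelings the compatible
  marks number 2 to the power of the number of components, isolated classes included; against free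
  marks on both sides this is a factor 2^(c-|W|), with W the set of non-isolated classes. An overlap
  r saves r choose 2 edges, but g(r) has one factor 2 less as soon as r >= 2; these missing factors
  supply 2^|E|. The obstacle in the last step is that the stubs left over after removing the pairs
  of a skeleton depend on the pairs chosen, whereas the residual model has fixed labels. Since the
  weight sees a matching only through its cell counts, stubs may be renamed inside their slots, and
  every choice gives the same residual sum. The denominator (n)_J is the quotient n!/(n-J)! of the
  numbers of perfect matchings before and after the removal. The assumption U >= 2 gives R_0 >= 1,
  so that skeleton cells have multiplicity at least 2 and are edges of the overlap graph.\<close>

lemma fibrewise_bijection:
  assumes "finite X" "finite X'"
    and card: "\<And>a. card {x \<in> X. f x = a} = card {x \<in> X'. f' x = a}"
  obtains \<rho> where "bij_betw \<rho> X X'" "\<And>x. x \<in> X \<Longrightarrow> f' (\<rho> x) = f x"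
proof -
  have "\<forall>a. \<exists>h. bij_betw h {x \<in> X. f x = a} {x \<in> X'. f' x = a}"
    using assms by (intro allI finite_same_card_bij) auto
  from choice[OF this] obtain h where h: "\<And>a. bij_betw (h a) {x \<in> X. f x = a} {x \<in> X'. f' x = a}"
    by blast
  have in_X': "h (f x) x \<in> X'" and f_h: "f' (h (f x) x) = f x" if "x \<in> X" for x
    using bij_betw_apply[OF h, of x "f x"] that by auto
  \<comment> \<open>The fibrewise bijections \<open>h a\<close> glue, because \<open>f'\<close> of
    an image recovers the fibre it came from.\<close>
  have "bij_betw (\<lambda>x. h (f x) x) X X'"
    unfolding bij_betw_def
  proof
    show "inj_on (\<lambda>x. h (f x) x) X"
    proof (rule inj_onI)
      fix x y assume xy: "x \<in> X" "y \<in> X" "h (f x) x = h (f y) y"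
      then have "f x = f y"
        using f_h by metis
      then show "x = y"
        using inj_onD[OF bij_betw_imp_inj_on[OF h[of "f x"]], of x y] xy by simp
    qed
    show "(\<lambda>x. h (f x) x) ` X = X'"
    proof
      show "X' \<subseteq> (\<lambda>x. h (f x) x) ` X"
      proof
        fix y assume "y \<in> X'"
        then have "y \<in> h (f' y) ` {x \<in> X. f x = f' y}"
          using bij_betw_imp_surj_on[OF h[of "f' y"]] by simp
        then obtain x where "x \<in> X" "f x = f' y" "y = h (f' y) x"
          by blast
        then show "y \<in> (\<lambda>x. h (f x) x) ` X"
          by (intro image_eqI[of _ _ x]) simp_all
      qed
    qed (use in_X' in auto)
  qed
  with f_h show thesis
    using that by blast
qed

text \<open>In terms of the two projections, matchings restrict, unite and map by standard facts on
  \<open>inj_on\<close> and images; the splitting and gluing arguments rely on this form.\<close>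

lemma perfect_matchings_iff:
  "F \<in> perfect_matchings X Y \<longleftrightarrow>
     F \<subseteq> X \<times> Y \<and> inj_on fst F \<and> inj_on snd F \<and> fst ` F = X \<and> snd ` F = Y"
proof
  assume F: "F \<in> perfect_matchings X Y"
  then have sub: "F \<subseteq> X \<times> Y" and x: "\<And>x. x \<in> X \<Longrightarrow> \<exists>!y. (x, y) \<in> F"
    and y: "\<And>y. y \<in> Y \<Longrightarrow> \<exists>!x. (x, y) \<in> F"
    by (auto simp: perfect_matchings_def)
  have "inj_on fst F"
    using sub x by (fastforce intro!: inj_onI)
  moreover have "inj_on snd F"
    using sub y by (fastforce intro!: inj_onI)
  moreover have "fst ` F = X" "snd ` F = Y"
    using sub x y by (force simp: image_iff)+
  ultimately show "F \<subseteq> X \<times> Y \<and> inj_on fst F \<and> inj_on snd F \<and> fst ` F = X \<and> snd ` F = Y"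
    using sub by blast
next
  assume F: "F \<subseteq> X \<times> Y \<and> inj_on fst F \<and> inj_on snd F \<and> fst ` F = X \<and> snd ` F = Y"
  have "\<exists>!y. (x, y) \<in> F" if "x \<in> X" for x
  proof -
    have "x \<in> fst ` F"
      using F that by blast
    then obtain y where "(x, y) \<in> F"
      by auto
    then show ?thesis
      using F inj_onD[of fst F "(x, _)" "(x, _)"] by auto
  qed
  moreover have "\<exists>!x. (x, y) \<in> F" if "y \<in> Y" for y
  proof -
    have "y \<in> snd ` F"
      using F that by blast
    then obtain x where "(x, y) \<in> F"
      by auto
    then show ?thesis
      using F inj_onD[of snd F "(_, y)" "(_, y)"] by auto
  qed
  ultimately show "F \<in> perfect_matchings X Y"
    using F by (auto simp: perfect_matchings_def)
qed

lemma perfect_matchings_fst: "F \<in> perfect_matchings X Y \<Longrightarrow> fst ` F = X"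
  and perfect_matchings_snd: "F \<in> perfect_matchings X Y \<Longrightarrow> snd ` F = Y"
  by (simp_all add: perfect_matchings_iff)

lemma finite_perfect_matchings:
  "finite X \<Longrightarrow> finite Y \<Longrightarrow> finite (perfect_matchings X Y)"
  by (rule finite_subset[of _ "Pow (X \<times> Y)"]) (auto simp: perfect_matchings_def)

section \<open>Labelings by bijections and the matchings they induce\<close>

definition bijections :: "'a set \<Rightarrow> 'b set \<Rightarrow> ('a \<Rightarrow> 'b) set" where
  "bijections X Y = {f \<in> X \<rightarrow>\<^sub>E Y. bij_betw f X Y}"

lemma finite_bijections: "finite X \<Longrightarrow> finite Y \<Longrightarrow> finite (bijections X Y)"
  unfolding bijections_def by (rule finite_subset[OF _ finite_PiE[of X "\<lambda>_. Y"]]) auto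

lemma card_bijections:
  assumes "finite X" "finite Y" "card X = card Y"
  shows "card (bijections X Y) = fact (card X)"
proof -
  have "bijections X Y = {f \<in> X \<rightarrow>\<^sub>E Y. inj_on f X}"
  proof -
    have "f ` X = Y" if "f \<in> X \<rightarrow>\<^sub>E Y" "inj_on f X" for f
      using that assms by (intro card_subset_eq) (auto simp: card_image)
    then show ?thesis
      by (auto simp: bijections_def bij_betw_def)
  qed
  then show ?thesis
    using card_inj_on_subset_funcset[of X Y X] assms
    by (simp add: fact_prod_rev atLeast0LessThan)
qed

text \<open>Two labelings with the same label set match the stubs with equal labels. For fixed
  \<open>\<phi>\<close> nothing is lost: \<open>\<psi>\<close> is recovered at \<open>y\<close> as
  the label under \<open>\<phi>\<close> of the partner of \<open>y\<close>. Hence a uniform second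
  labeling amounts to a uniform perfect matching.\<close>

lemma bij_betw_bijections_matchings:
  assumes "\<phi> \<in> bijections X N"
  shows "bij_betw (\<lambda>\<psi>. {(x, y) \<in> X \<times> Y. \<phi> x = \<psi> y}) (bijections Y N) (perfect_matchings X Y)"
proof (rule bij_betwI[where g = "\<lambda>F. \<lambda>y\<in>Y. \<phi> (THE x. (x, y) \<in> F)"])
  have \<phi>: "bij_betw \<phi> X N"
    using assms by (simp add: bijections_def)
  show "(\<lambda>\<psi>. {(x, y) \<in> X \<times> Y. \<phi> x = \<psi> y}) \<in> bijections Y N \<rightarrow> perfect_matchings X Y"
  proof
    fix \<psi> assume "\<psi> \<in> bijections Y N"
    then have \<psi>: "bij_betw \<psi> Y N"
      by (simp add: bijections_def)
    have "\<exists>!y. (x, y) \<in> {(x, y) \<in> X \<times> Y. \<phi> x = \<psi> y}" if "x \<in> X" for x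
    proof -
      have "\<phi> x \<in> N" using \<phi> that by (auto simp: bij_betw_def)
      then show ?thesis
        using \<psi> that by (auto simp: bij_betw_def inj_on_def)
    qed
    moreover have "\<exists>!x. (x, y) \<in> {(x, y) \<in> X \<times> Y. \<phi> x = \<psi> y}" if "y \<in> Y" for y
    proof -
      have "\<psi> y \<in> N" using \<psi> that by (auto simp: bij_betw_def)
      then show ?thesis
        using \<phi> that by (auto simp: bij_betw_def inj_on_def)
    qed
    ultimately show "{(x, y) \<in> X \<times> Y. \<phi> x = \<psi> y} \<in> perfect_matchings X Y"
      by (auto simp: perfect_matchings_def)
  qed
  show "(\<lambda>F. \<lambda>y\<in>Y. \<phi> (THE x. (x, y) \<in> F)) \<in> perfect_matchings X Y \<rightarrow> bijections Y N"
  proof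
    fix F assume F: "F \<in> perfect_matchings X Y"
    define h where "h y = (THE x. (x, y) \<in> F)" for y
    have h: "(x, y) \<in> F \<longleftrightarrow> x = h y" if "y \<in> Y" for x y
    proof -
      have "\<exists>!x. (x, y) \<in> F"
        using F that by (auto simp: perfect_matchings_def)
      then show ?thesis
        using theI'[of "\<lambda>x. (x, y) \<in> F"] unfolding h_def by blast
    qed
    have hX: "h y \<in> X" if "y \<in> Y" for y
      using h[OF that, of "h y"] F by (auto simp: perfect_matchings_def)
    have "bij_betw h Y X"
      unfolding bij_betw_def
    proof
      show "inj_on h Y"
      proof (rule inj_onI)
        fix y z assume yz: "y \<in> Y" "z \<in> Y" "h y = h z"
        then have "(h y, y) \<in> F" "(h y, z) \<in> F"
          using h[of y "h y"] h[of z "h y"] by simp_all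
        moreover have "\<exists>!y'. (h y, y') \<in> F"
          using F hX[OF yz(1)] by (simp add: perfect_matchings_def)
        ultimately show "y = z"
          by blast
      qed
      show "h ` Y = X"
      proof
        show "X \<subseteq> h ` Y"
        proof
          fix x assume "x \<in> X"
          then obtain y where "(x, y) \<in> F"
            using F by (auto simp: perfect_matchings_def)
          moreover then have "y \<in> Y"
            using F by (auto simp: perfect_matchings_def)
          ultimately show "x \<in> h ` Y"
            using h by blast
        qed
      qed (use hX in auto)
    qed
    then have "bij_betw (\<lambda>y\<in>Y. \<phi> (h y)) Y N"
      using bij_betw_trans[OF _ \<phi>, of h Y] by (simp add: bij_betw_def inj_on_def)
    then show "(\<lambda>y\<in>Y. \<phi> (THE x. (x, y) \<in> F)) \<in> bijections Y N"
      by (auto simp: bijections_def bij_betw_def h_def)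
  qed
  show "(\<lambda>y\<in>Y. \<phi> (THE x. (x, y) \<in> {(x, y) \<in> X \<times> Y. \<phi> x = \<psi> y})) = \<psi>"
    if "\<psi> \<in> bijections Y N" for \<psi>
  proof
    fix y
    show "(\<lambda>y\<in>Y. \<phi> (THE x. (x, y) \<in> {(x, y) \<in> X \<times> Y. \<phi> x = \<psi> y})) y = \<psi> y"
    proof (cases "y \<in> Y")
      case True
      then have "\<psi> y \<in> N"
        using that by (auto simp: bijections_def)
      then obtain x where x: "x \<in> X" "\<phi> x = \<psi> y"
        using \<phi> by (auto simp: bij_betw_def)
      have "(THE x. (x, y) \<in> {(x, y) \<in> X \<times> Y. \<phi> x = \<psi> y}) = x"
        by (rule the_equality) (use x True \<phi> in \<open>auto simp: bij_betw_def inj_on_def\<close>)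
      then show ?thesis
        using x True by simp
    qed (use that in \<open>auto simp: bijections_def\<close>)
  qed
  show "{(x, y) \<in> X \<times> Y. \<phi> x = (\<lambda>y\<in>Y. \<phi> (THE x. (x, y) \<in> F)) y} = F"
    if F: "F \<in> perfect_matchings X Y" for F
  proof -
    have "\<phi> x = \<phi> (THE x. (x, y) \<in> F) \<longleftrightarrow> (x, y) \<in> F" if "x \<in> X" "y \<in> Y" for x y
    proof -
      have "\<exists>!z. (z, y) \<in> F"
        using F that by (simp add: perfect_matchings_def)
      then obtain z where z: "(z, y) \<in> F" and uniq: "\<And>w. (w, y) \<in> F \<Longrightarrow> w = z"
        by blast
      have "z \<in> X"
        using F z by (auto simp: perfect_matchings_def)
      have "(THE x. (x, y) \<in> F) = z"
        using z uniq by (rule the_equality)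
      moreover have "\<phi> x = \<phi> z \<longleftrightarrow> x = z"
        using \<phi> \<open>z \<in> X\<close> \<open>x \<in> X\<close> by (auto simp: bij_betw_def dest: inj_onD)
      ultimately show ?thesis
        using z uniq[of x] by auto
    qed
    then show ?thesis
      using F by (auto simp: perfect_matchings_def)
  qed
qed

lemma card_perfect_matchings:
  assumes "finite X" "finite Y" "card X = card Y"
  shows "card (perfect_matchings X Y) = fact (card X)"
proof -
  \<comment> \<open>Labeling \<open>X\<close> by itself turns perfect matchings into bijections from
    \<open>Y\<close> to \<open>X\<close>.\<close>
  have "restrict id X \<in> bijections X X"
    by (auto simp: bijections_def bij_betw_def inj_on_def)
  from bij_betw_bijections_matchings[OF this, of Y] show ?thesis
    using assms card_bijections[of Y X] by (simp add: bij_betw_same_card[symmetric])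
qed

section \<open>Counting partial matchings\<close>

definition partial_matchings :: "'a set \<Rightarrow> 'b set \<Rightarrow> nat \<Rightarrow> ('a \<times> 'b) set set" where
  "partial_matchings X Y r = {K. K \<subseteq> X \<times> Y \<and> inj_on fst K \<and> inj_on snd K \<and> card K = r}"

lemma falling_eq: "falling x r = real (x choose r) * fact r"
  by (simp add: falling_def binomial_gbinomial gbinomial_prod_rev atLeast0LessThan)

lemma falling_fact: "r \<le> x \<Longrightarrow> falling x r * fact (x - r) = fact x"
  by (simp add: falling_eq binomial_fact)

text \<open>A partial matching with r pairs is a perfect matching between its two projections, each
  of size r. The resulting count (x choose r)(y choose r) r! is the factor (x)_r (y)_r / r! of a
  single cell in \<open>w_hi\<close>.\<close>

lemma card_partial_matchings:
  assumes [simp]: "finite X" "finite Y"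
  shows "real (card (partial_matchings X Y r)) =
           falling (card X) r * falling (card Y) r / fact r"
proof -
  let ?I = "{A. A \<subseteq> X \<and> card A = r} \<times> {B. B \<subseteq> Y \<and> card B = r}"
  have eq: "partial_matchings X Y r = (\<Union>(A, B)\<in>?I. perfect_matchings A B)"
  proof (intro equalityI subsetI)
    fix K assume "K \<in> partial_matchings X Y r"
    then have "K \<in> perfect_matchings (fst ` K) (snd ` K)" "(fst ` K, snd ` K) \<in> ?I"
      by (force simp: perfect_matchings_iff partial_matchings_def card_image)+
    then show "K \<in> (\<Union>(A, B)\<in>?I. perfect_matchings A B)"
      by blast
  next
    fix K assume "K \<in> (\<Union>(A, B)\<in>?I. perfect_matchings A B)"
    then show "K \<in> partial_matchings X Y r"
      by (auto simp: perfect_matchings_iff partial_matchings_def card_image)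
  qed
  have fin: "finite ?I" "\<And>p. p \<in> ?I \<Longrightarrow> finite (fst p) \<and> finite (snd p)"
    by (auto intro: finite_subset[OF _ assms(1)] finite_subset[OF _ assms(2)])
  have "card (partial_matchings X Y r) = (\<Sum>p\<in>?I. card (perfect_matchings (fst p) (snd p)))"
    unfolding eq split_def
  proof (rule card_UN_disjoint)
    show "\<forall>p\<in>?I. finite (perfect_matchings (fst p) (snd p))"
      using fin(2) finite_perfect_matchings by blast
    show "\<forall>p\<in>?I. \<forall>q\<in>?I. p \<noteq> q \<longrightarrow>
      perfect_matchings (fst p) (snd p) \<inter> perfect_matchings (fst q) (snd q) = {}"
    proof (intro ballI impI equals0I)
      fix p q K assume "p \<noteq> q" and K: "K \<in> perfect_matchings (fst p) (snd p) \<inter> perfect_matchings (fst q) (snd q)"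
      have "fst p = fst q" "snd p = snd q"
        using perfect_matchings_fst[OF IntD1[OF K]] perfect_matchings_fst[OF IntD2[OF K]]
          perfect_matchings_snd[OF IntD1[OF K]] perfect_matchings_snd[OF IntD2[OF K]]
        by (metis, metis)
      with \<open>p \<noteq> q\<close> show False
        by (simp add: prod_eq_iff)
    qed
  qed (rule fin)
  also have "\<dots> = (\<Sum>p\<in>?I. fact r)"
  proof (rule sum.cong[OF refl])
    fix p assume p: "p \<in> ?I"
    then have "card (fst p) = r" "card (snd p) = r"
      by auto
    with fin(2)[OF p] show "card (perfect_matchings (fst p) (snd p)) = fact r"
      by (simp add: card_perfect_matchings)
  qed
  also have "\<dots> = (card X choose r) * (card Y choose r) * fact r"
    by (simp add: n_subsets card_cartesian_product)
  finally show ?thesis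
    by (simp add: falling_eq)
qed

section \<open>Transport of perfect matchings along bijections of the two sides\<close>

lemma map_prod_perfect_matchings:
  assumes \<rho>: "bij_betw \<rho> X X'" and \<tau>: "bij_betw \<tau> Y Y'" and F: "F \<in> perfect_matchings X Y"
  shows "map_prod \<rho> \<tau> ` F \<in> perfect_matchings X' Y'"
proof -
  have sub: "F \<subseteq> X \<times> Y" and im: "fst ` F = X" "snd ` F = Y" and inj: "inj_on fst F" "inj_on snd F"
    using F by (auto simp: perfect_matchings_iff)
  have "inj_on (\<rho> \<circ> fst) F" "inj_on (\<tau> \<circ> snd) F"
    using inj im \<rho> \<tau> by (auto simp: bij_betw_def intro!: comp_inj_on)
  then have "inj_on fst (map_prod \<rho> \<tau> ` F)" "inj_on snd (map_prod \<rho> \<tau> ` F)"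
    by (auto simp: inj_on_def)
  moreover have "fst ` map_prod \<rho> \<tau> ` F = \<rho> ` fst ` F" "snd ` map_prod \<rho> \<tau> ` F = \<tau> ` snd ` F"
    by (simp_all add: image_image)
  moreover have "map_prod \<rho> \<tau> ` F \<subseteq> X' \<times> Y'"
    using sub \<rho> \<tau> by (auto simp: bij_betw_def)
  ultimately show ?thesis
    using im \<rho> \<tau> by (simp add: perfect_matchings_iff bij_betw_def)
qed

lemma bij_betw_perfect_matchings:
  assumes \<rho>: "bij_betw \<rho> X X'" and \<tau>: "bij_betw \<tau> Y Y'"
  shows "bij_betw ((`) (map_prod \<rho> \<tau>)) (perfect_matchings X Y) (perfect_matchings X' Y')"
proof (rule bij_betwI[where g = "(`) (map_prod (inv_into X \<rho>) (inv_into Y \<tau>))"])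
  show "map_prod (inv_into X \<rho>) (inv_into Y \<tau>) ` map_prod \<rho> \<tau> ` F = F"
    if "F \<in> perfect_matchings X Y" for F
  proof -
    have "map_prod (inv_into X \<rho>) (inv_into Y \<tau>) (map_prod \<rho> \<tau> p) = p" if "p \<in> F" for p
      using \<open>F \<in> _\<close> that \<rho> \<tau>
      by (cases p) (auto simp: perfect_matchings_def bij_betw_def subset_iff inv_into_f_f)
    then show ?thesis
      by (force simp: image_image)
  qed
  show "map_prod \<rho> \<tau> ` map_prod (inv_into X \<rho>) (inv_into Y \<tau>) ` F = F"
    if "F \<in> perfect_matchings X' Y'" for F
  proof -
    have "map_prod \<rho> \<tau> (map_prod (inv_into X \<rho>) (inv_into Y \<tau>) p) = p" if "p \<in> F" for p
      using \<open>F \<in> _\<close> that \<rho> \<tau>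
      by (cases p) (auto simp: perfect_matchings_def bij_betw_def subset_iff f_inv_into_f)
    then show ?thesis
      by (force simp: image_image)
  qed
qed (use assms in \<open>auto intro!: map_prod_perfect_matchings bij_betw_inv_into\<close>)

section \<open>Splitting off the cells of a skeleton\<close>

definition cell_of :: "stub \<times> stub \<Rightarrow> cell" where
  "cell_of p = (fst (fst p), fst (snd p))"

lemma cell_count_eq: "cell_count F e = card {p \<in> F. cell_of p = e}"
  unfolding cell_count_def by (rule arg_cong[of _ _ card]) (cases e; auto simp: cell_of_def)

lemma cell_count_eq_0_iff: "finite F \<Longrightarrow> cell_count F e = 0 \<longleftrightarrow> (\<forall>p\<in>F. cell_of p \<noteq> e)"
  unfolding cell_count_eq by (subst card_0_eq) (auto simp del: split_paired_All)

lemma cell_count_map_prod: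
  assumes F: "F \<subseteq> X \<times> Y" and inj: "inj_on \<rho> X" "inj_on \<tau> Y"
    and "\<And>x. x \<in> X \<Longrightarrow> fst (\<rho> x) = fst x" "\<And>y. y \<in> Y \<Longrightarrow> fst (\<tau> y) = fst y"
  shows "cell_count (map_prod \<rho> \<tau> ` F) = cell_count F"
proof
  fix e
  have cell: "cell_of (map_prod \<rho> \<tau> p) = cell_of p" if "p \<in> F" for p
    using F assms(4,5) that by (cases p) (auto simp: cell_of_def)
  have "{p \<in> map_prod \<rho> \<tau> ` F. cell_of p = e} = map_prod \<rho> \<tau> ` {p \<in> F. cell_of p = e}"
    using cell by auto
  moreover have "inj_on (map_prod \<rho> \<tau>) {p \<in> F. cell_of p = e}"
    using F by (intro inj_on_subset[OF map_prod_inj_on[OF inj]]) auto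
  ultimately show "cell_count (map_prod \<rho> \<tau> ` F) e = cell_count F e"
    by (simp add: cell_count_eq card_image)
qed

text \<open>Bijections that keep the slot of each stub preserve all cell counts, so only the number
  of stubs in each slot matters. This replaces leftover stubs, whose labels depend on what was
  removed, by the standard residual stubs.\<close>

lemma sum_perfect_matchings_relabel:
  fixes h :: "(cell \<Rightarrow> nat) \<Rightarrow> real"
  assumes "finite X" "finite X'" "finite Y" "finite Y'"
    and "\<And>a. card {x \<in> X. fst x = a} = card {x \<in> X'. fst x = a}"
    and "\<And>a. card {y \<in> Y. fst y = a} = card {y \<in> Y'. fst y = a}"
  shows "(\<Sum>F\<in>perfect_matchings X Y. h (cell_count F)) =
         (\<Sum>F\<in>perfect_matchings X' Y'. h (cell_count F))"
proof -
  obtain \<rho> where \<rho>: "bij_betw \<rho> X X'" "\<And>x. x \<in> X \<Longrightarrow> fst (\<rho> x) = fst x"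
    using fibrewise_bijection[of X X' fst fst] assms by metis
  obtain \<tau> where \<tau>: "bij_betw \<tau> Y Y'" "\<And>y. y \<in> Y \<Longrightarrow> fst (\<tau> y) = fst y"
    using fibrewise_bijection[of Y Y' fst fst] assms by metis
  have "(\<Sum>F\<in>perfect_matchings X' Y'. h (cell_count F)) =
        (\<Sum>F\<in>perfect_matchings X Y. h (cell_count (map_prod \<rho> \<tau> ` F)))"
    using sum.reindex_bij_betw[OF bij_betw_perfect_matchings[OF \<rho>(1) \<tau>(1)], of "\<lambda>F. h (cell_count F)"]
    by simp
  also have "\<dots> = (\<Sum>F\<in>perfect_matchings X Y. h (cell_count F))"
  proof (rule sum.cong[OF refl])
    fix F assume "F \<in> perfect_matchings X Y"
    then have "F \<subseteq> X \<times> Y"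
      by (simp add: perfect_matchings_def)
    then show "h (cell_count (map_prod \<rho> \<tau> ` F)) = h (cell_count F)"
      using cell_count_map_prod[of F X Y \<rho> \<tau>] \<rho> \<tau> by (simp add: bij_betw_def)
  qed
  finally show ?thesis ..
qed

text \<open>The candidates for the part of a perfect matching lying in the cells of
  \<open>M\<close>; the stubs they leave free are to be matched elsewhere.\<close>

definition skeleton_matchings ::
    "stub set \<Rightarrow> stub set \<Rightarrow> cell set \<Rightarrow> (cell \<Rightarrow> nat) \<Rightarrow> (stub \<times> stub) set set" where
  "skeleton_matchings X Y M j =
     {K. K \<subseteq> X \<times> Y \<and> inj_on fst K \<and> inj_on snd K \<and> cell_of ` K \<subseteq> M \<and> (\<forall>e\<in>M. cell_count K e = j e)}"

lemma finite_skeleton_matchings: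
  "finite X \<Longrightarrow> finite Y \<Longrightarrow> finite (skeleton_matchings X Y M j)"
  by (rule finite_subset[of _ "Pow (X \<times> Y)"]) (auto simp: skeleton_matchings_def)

text \<open>Cells of \<open>M\<close> share no slot, so pairs chosen in different cells never share
  a stub. The choices in the cells are therefore independent, and any family of them glues to one
  partial matching.\<close>

lemma bij_betw_skeleton_matchings:
  assumes disj: "\<And>e f. e \<in> M \<Longrightarrow> f \<in> M \<Longrightarrow> e \<noteq> f \<Longrightarrow> fst e \<noteq> fst f \<and> snd e \<noteq> snd f"
  shows "bij_betw (\<lambda>K. \<lambda>e\<in>M. {p \<in> K. cell_of p = e}) (skeleton_matchings X Y M j)
           (\<Pi>\<^sub>E e\<in>M. partial_matchings {x \<in> X. fst x = fst e} {y \<in> Y. fst y = snd e} (j e))"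
proof (rule bij_betwI[where g = "\<lambda>q. \<Union>e\<in>M. q e"])
  let ?Q = "\<Pi>\<^sub>E e\<in>M. partial_matchings {x \<in> X. fst x = fst e} {y \<in> Y. fst y = snd e} (j e)"
  show "(\<lambda>K. \<lambda>e\<in>M. {p \<in> K. cell_of p = e}) \<in> skeleton_matchings X Y M j \<rightarrow> ?Q"
  proof (intro Pi_I PiE_I)
    fix K e assume "K \<in> skeleton_matchings X Y M j" "e \<in> M"
    then show "(\<lambda>e\<in>M. {p \<in> K. cell_of p = e}) e \<in>
        partial_matchings {x \<in> X. fst x = fst e} {y \<in> Y. fst y = snd e} (j e)"
      by (auto simp: skeleton_matchings_def partial_matchings_def cell_count_eq cell_of_def
          intro: inj_on_subset)
  qed auto
  have q_cell: "cell_of p = e" if "q \<in> ?Q" "e \<in> M" "p \<in> q e" for q p e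
    using PiE_mem[OF that(1,2)] that(3) by (cases e) (auto simp: partial_matchings_def cell_of_def)
  have q_part: "{p \<in> \<Union>e\<in>M. q e. cell_of p = e} = q e" if "q \<in> ?Q" "e \<in> M" for q e
    using q_cell[OF that(1)] that(2) by blast
  show "(\<lambda>q. \<Union>e\<in>M. q e) \<in> ?Q \<rightarrow> skeleton_matchings X Y M j"
  proof
    fix q assume q: "q \<in> ?Q"
    have part: "q e \<subseteq> X \<times> Y" "inj_on fst (q e)" "inj_on snd (q e)" "card (q e) = j e"
      if "e \<in> M" for e
      using PiE_mem[OF q that] by (auto simp: partial_matchings_def)
    \<comment> \<open>Two pairs with a common stub have cells with a common slot, which forces the
      cells to be equal; injectivity on the union thus reduces to a single cell.\<close>
    have eq: "e = f" if "p \<in> q e" "p' \<in> q f" "e \<in> M" "f \<in> M" "fst p = fst p' \<or> snd p = snd p'" for e f p p'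
    proof (rule ccontr)
      assume "e \<noteq> f"
      with disj[OF that(3,4)] have "fst (cell_of p) \<noteq> fst (cell_of p')" "snd (cell_of p) \<noteq> snd (cell_of p')"
        using q_cell[OF q that(3,1)] q_cell[OF q that(4,2)] by simp_all
      with that(5) show False
        by (auto simp: cell_of_def)
    qed
    have "inj_on fst (\<Union>e\<in>M. q e)"
    proof (rule inj_onI)
      fix p p' assume "p \<in> (\<Union>e\<in>M. q e)" "p' \<in> (\<Union>e\<in>M. q e)" and same: "fst p = fst p'"
      then obtain e f where "p \<in> q e" "p' \<in> q f" "e \<in> M" "f \<in> M"
        by blast
      with eq[OF this] same part(2)[of e] show "p = p'"
        by (auto dest: inj_onD)
    qed
    moreover have "inj_on snd (\<Union>e\<in>M. q e)"
    proof (rule inj_onI)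
      fix p p' assume "p \<in> (\<Union>e\<in>M. q e)" "p' \<in> (\<Union>e\<in>M. q e)" and same: "snd p = snd p'"
      then obtain e f where "p \<in> q e" "p' \<in> q f" "e \<in> M" "f \<in> M"
        by blast
      with eq[OF this] same part(3)[of e] show "p = p'"
        by (auto dest: inj_onD)
    qed
    moreover have "cell_count (\<Union>e\<in>M. q e) e = j e" if "e \<in> M" for e
      unfolding cell_count_eq q_part[OF q that] using part that by simp
    moreover have "cell_of ` (\<Union>e\<in>M. q e) \<subseteq> M"
      using q_cell[OF q] by auto
    ultimately show "(\<Union>e\<in>M. q e) \<in> skeleton_matchings X Y M j"
      using part(1) unfolding skeleton_matchings_def by blast
  qed
  show "(\<Union>e\<in>M. (\<lambda>e\<in>M. {p \<in> K. cell_of p = e}) e) = K" if "K \<in> skeleton_matchings X Y M j" for K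
    using that by (auto simp: skeleton_matchings_def)
  show "(\<lambda>e\<in>M. {p \<in> \<Union>e\<in>M. q e. cell_of p = e}) = q" if "q \<in> ?Q" for q
  proof
    fix e
    show "(\<lambda>e\<in>M. {p \<in> \<Union>e\<in>M. q e. cell_of p = e}) e = q e"
    proof (cases "e \<in> M")
      case True
      then show ?thesis
        using q_part[OF that True] by simp
    next
      case False
      then show ?thesis
        using that by (simp add: PiE_arb[OF that])
    qed
  qed
qed

text \<open>The inverse sorts the pairs of a matching by whether their cell is in \<open>M\<close>.
  Requiring count 0 on \<open>M\<close> for the remainder makes the decomposition unique; it is also
  one of the two conditions in the residual event.\<close>

lemma bij_betw_split_matching:
  assumes "finite X" "finite Y"
  shows "bij_betw (\<lambda>(K, F). K \<union> F)
    (Sigma (skeleton_matchings X Y M j)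
       (\<lambda>K. {F \<in> perfect_matchings (X - fst ` K) (Y - snd ` K). \<forall>e\<in>M. cell_count F e = 0}))
    {F \<in> perfect_matchings X Y. \<forall>e\<in>M. cell_count F e = j e}"
proof (rule bij_betwI[where g = "\<lambda>F. ({p \<in> F. cell_of p \<in> M}, {p \<in> F. cell_of p \<notin> M})"])
  let ?D = "Sigma (skeleton_matchings X Y M j)
       (\<lambda>K. {F \<in> perfect_matchings (X - fst ` K) (Y - snd ` K). \<forall>e\<in>M. cell_count F e = 0})"
  let ?R = "{F \<in> perfect_matchings X Y. \<forall>e\<in>M. cell_count F e = j e}"
  \<comment> \<open>Finiteness of \<open>F\<close> enters here: for an infinite set of pairs, a cell
    count 0 would not exclude pairs in that cell.\<close>
  have notin: "cell_of p \<notin> M"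
    if F: "F \<in> perfect_matchings (X - A) (Y - B)" and 0: "\<forall>e\<in>M. cell_count F e = 0" and p: "p \<in> F" for A B F p
  proof -
    have "F \<subseteq> X \<times> Y"
      using F by (auto simp: perfect_matchings_def)
    then have "finite F"
      using assms by (auto intro: finite_subset)
    then show ?thesis
      using 0 p cell_count_eq_0_iff by blast
  qed
  show "(\<lambda>(K, F). K \<union> F) \<in> ?D \<rightarrow> ?R"
  proof (clarify, intro conjI ballI)
    fix K F assume K: "K \<in> skeleton_matchings X Y M j"
      and F: "F \<in> perfect_matchings (X - fst ` K) (Y - snd ` K)" and 0: "\<forall>e\<in>M. cell_count F e = 0"
    show "K \<union> F \<in> perfect_matchings X Y"
      using K F unfolding skeleton_matchings_def perfect_matchings_iff
      by (auto simp: inj_on_Un image_Un)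
    show "cell_count (K \<union> F) e = j e" if "e \<in> M" for e
    proof -
      have "{p \<in> K \<union> F. cell_of p = e} = {p \<in> K. cell_of p = e}"
        using notin[OF F 0] that by auto
      then show ?thesis
        using K that by (simp add: cell_count_eq skeleton_matchings_def)
    qed
  qed
  show "(\<lambda>F. ({p \<in> F. cell_of p \<in> M}, {p \<in> F. cell_of p \<notin> M})) \<in> ?R \<rightarrow> ?D"
  proof
    fix F assume F: "F \<in> ?R"
    then have FX: "F \<subseteq> X \<times> Y" "inj_on fst F" "inj_on snd F" "fst ` F = X" "snd ` F = Y"
      by (auto simp: perfect_matchings_iff)
    let ?K = "{p \<in> F. cell_of p \<in> M}" and ?L = "{p \<in> F. cell_of p \<notin> M}"
    have L: "?L = F - ?K"
      by auto
    have "?K \<in> skeleton_matchings X Y M j"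
    proof -
      have "{p \<in> ?K. cell_of p = e} = {p \<in> F. cell_of p = e}" if "e \<in> M" for e
        using that by auto
      then show ?thesis
        using F FX by (auto simp: skeleton_matchings_def cell_count_eq intro: inj_on_subset)
    qed
    moreover have "fst ` ?L = X - fst ` ?K" "snd ` ?L = Y - snd ` ?K"
      using inj_on_image_set_diff[of fst F F ?K] inj_on_image_set_diff[of snd F F ?K] FX unfolding L by auto
    then have "?L \<in> perfect_matchings (X - fst ` ?K) (Y - snd ` ?K)"
      unfolding perfect_matchings_iff
      using subset_fst_snd[of ?L] inj_on_subset[OF FX(2), of ?L] inj_on_subset[OF FX(3), of ?L] by auto
    moreover have "cell_count ?L e = 0" if "e \<in> M" for e
    proof -
      have "{p \<in> ?L. cell_of p = e} = {}"
        using that by auto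
      then show ?thesis
        unfolding cell_count_eq by (simp only: card.empty)
    qed
    ultimately show "(?K, ?L) \<in> ?D"
      by blast
  qed
  show "(\<lambda>F. ({p \<in> F. cell_of p \<in> M}, {p \<in> F. cell_of p \<notin> M})) ((\<lambda>(K, F). K \<union> F) z) = z"
    if zD: "z \<in> ?D" for z
  proof -
    obtain K F where z: "z = (K, F)" "K \<in> skeleton_matchings X Y M j"
      "F \<in> perfect_matchings (X - fst ` K) (Y - snd ` K)" "\<forall>e\<in>M. cell_count F e = 0"
      using zD by blast
    have "cell_of p \<in> M" if "p \<in> K" for p
      using that z(2) by (auto simp: skeleton_matchings_def)
    then show ?thesis
      using notin[OF z(3,4)] by (auto simp: z(1))
  qed
qed auto

text \<open>Each pair of \<open>K\<close> lies in a cell of \<open>M\<close> and uses its own row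
  stub, so \<open>K\<close> consumes the prescribed total of \<open>j\<close> in each row slot;
  likewise for columns. The number of free stubs per slot is thus the same for every
  \<open>K\<close>.\<close>

lemma card_residual_fibre:
  fixes K :: "(stub \<times> stub) set"
  assumes K: "K \<in> skeleton_matchings X Y M j" and fin: "finite X" "finite Y" "finite M"
  shows "card {x \<in> X - fst ` K. fst x = a} = card {x \<in> X. fst x = a} - (\<Sum>b | (a, b) \<in> M. j (a, b))"
    and "card {y \<in> Y - snd ` K. fst y = b} = card {y \<in> Y. fst y = b} - (\<Sum>a | (a, b) \<in> M. j (a, b))"
proof -
  have K': "K \<subseteq> X \<times> Y" "inj_on fst K" "inj_on snd K" "cell_of ` K \<subseteq> M" "\<And>e. e \<in> M \<Longrightarrow> cell_count K e = j e"
    using K by (auto simp: skeleton_matchings_def)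
  have "finite K"
    using K'(1) fin by (auto intro: finite_subset)
  have finM: "finite {b. (a, b) \<in> M}" "finite {a. (a, b) \<in> M}"
    using finite_subset[of "{b. (a, b) \<in> M}" "snd ` M"] finite_subset[of "{a. (a, b) \<in> M}" "fst ` M"] fin
    by force+
  have "card {x \<in> fst ` K. fst x = a} = card (fst ` {p \<in> K. fst (fst p) = a})"
    by (rule arg_cong[of _ _ card]) auto
  also have "\<dots> = card {p \<in> K. fst (fst p) = a}"
    using K'(2) by (intro card_image) (auto intro: inj_on_subset)
  also have "{p \<in> K. fst (fst p) = a} = (\<Union>b\<in>{b. (a, b) \<in> M}. {p \<in> K. cell_of p = (a, b)})"
    using K'(4) by (auto simp: cell_of_def)
  also have "card \<dots> = (\<Sum>b | (a, b) \<in> M. cell_count K (a, b))"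
    unfolding cell_count_eq using finM \<open>finite K\<close> by (intro card_UN_disjoint) auto
  also have "\<dots> = (\<Sum>b | (a, b) \<in> M. j (a, b))"
    using K'(5) by simp
  finally have 1: "card {x \<in> fst ` K. fst x = a} = (\<Sum>b | (a, b) \<in> M. j (a, b))" .
  have "{x \<in> X - fst ` K. fst x = a} = {x \<in> X. fst x = a} - {x \<in> fst ` K. fst x = a}"
    by auto
  then show "card {x \<in> X - fst ` K. fst x = a} = card {x \<in> X. fst x = a} - (\<Sum>b | (a, b) \<in> M. j (a, b))"
    using K'(1) \<open>finite K\<close> by (simp add: 1[symmetric]) (intro card_Diff_subset; auto)
  have "card {y \<in> snd ` K. fst y = b} = card (snd ` {p \<in> K. fst (snd p) = b})"
    by (rule arg_cong[of _ _ card]) auto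
  also have "\<dots> = card {p \<in> K. fst (snd p) = b}"
    using K'(3) by (intro card_image) (auto intro: inj_on_subset)
  also have "{p \<in> K. fst (snd p) = b} = (\<Union>a\<in>{a. (a, b) \<in> M}. {p \<in> K. cell_of p = (a, b)})"
    using K'(4) by (auto simp: cell_of_def)
  also have "card \<dots> = (\<Sum>a | (a, b) \<in> M. cell_count K (a, b))"
    unfolding cell_count_eq using finM \<open>finite K\<close> by (intro card_UN_disjoint) auto
  also have "\<dots> = (\<Sum>a | (a, b) \<in> M. j (a, b))"
    using K'(5) by simp
  finally have 2: "card {y \<in> snd ` K. fst y = b} = (\<Sum>a | (a, b) \<in> M. j (a, b))" .
  have "{y \<in> Y - snd ` K. fst y = b} = {y \<in> Y. fst y = b} - {y \<in> snd ` K. fst y = b}"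
    by auto
  then show "card {y \<in> Y - snd ` K. fst y = b} = card {y \<in> Y. fst y = b} - (\<Sum>a | (a, b) \<in> M. j (a, b))"
    using K'(1) \<open>finite K\<close> by (simp add: 2[symmetric]) (intro card_Diff_subset; auto)
qed

text \<open>The sum that remains after removing \<open>K\<close> depends on \<open>K\<close> only
  through the numbers of free stubs per slot, hence not at all. So \<open>K\<close> contributes just
  the number of its choices, and any \<open>X'\<close>, \<open>Y'\<close> with the right slot counts
  may stand for the free stubs.\<close>

lemma sum_matchings_with_skeleton:
  fixes h :: "(cell \<Rightarrow> nat) \<Rightarrow> real"
  assumes fin: "finite X" "finite Y" "finite X'" "finite Y'" "finite M"
    and X': "\<And>a. card {x \<in> X'. fst x = a} = card {x \<in> X. fst x = a} - (\<Sum>b | (a, b) \<in> M. j (a, b))"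
    and Y': "\<And>b. card {y \<in> Y'. fst y = b} = card {y \<in> Y. fst y = b} - (\<Sum>a | (a, b) \<in> M. j (a, b))"
  shows "(\<Sum>F | F \<in> perfect_matchings X Y \<and> (\<forall>e\<in>M. cell_count F e = j e). h (cell_count F)) =
     card (skeleton_matchings X Y M j) *
     (\<Sum>F | F \<in> perfect_matchings X' Y' \<and> (\<forall>e\<in>M. cell_count F e = 0).
        h (\<lambda>e. if e \<in> M then j e else cell_count F e))"
proof -
  define R where "R = (\<lambda>K :: (stub \<times> stub) set.
    {F \<in> perfect_matchings (X - fst ` K) (Y - snd ` K). \<forall>e\<in>M. cell_count F e = 0})"
  \<comment> \<open>The restriction to count 0 on \<open>M\<close> is moved into the summand,
    because relabeling is available for sums over all perfect matchings.\<close>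
  define h' where "h' c = (if \<forall>e\<in>M. c e = 0 then h (\<lambda>e. if e \<in> M then j e else c e) else 0)" for c
  have finR: "finite (perfect_matchings (X - fst ` K) (Y - snd ` K))" for K :: "(stub \<times> stub) set"
    using fin by (intro finite_perfect_matchings) auto
  have count: "cell_count (K \<union> F) = (\<lambda>e. if e \<in> M then j e else cell_count F e)"
    if K: "K \<in> skeleton_matchings X Y M j" and F: "F \<in> R K" for K F
  proof
    fix e
    have "{p \<in> K \<union> F. cell_of p = e} = {p \<in> F. cell_of p = e}" if "e \<notin> M"
      using K that by (auto simp: skeleton_matchings_def)
    moreover have "cell_count (K \<union> F) e = j e" if "e \<in> M"
      using bij_betw_apply[OF bij_betw_split_matching[OF fin(1,2), of M j], of "(K, F)"] K F that
      by (auto simp: R_def)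
    ultimately show "cell_count (K \<union> F) e = (if e \<in> M then j e else cell_count F e)"
      by (auto simp: cell_count_eq)
  qed
  have "(\<Sum>F | F \<in> perfect_matchings X Y \<and> (\<forall>e\<in>M. cell_count F e = j e). h (cell_count F)) =
      (\<Sum>(K, F)\<in>Sigma (skeleton_matchings X Y M j) R. h (cell_count (K \<union> F)))"
    using sum.reindex_bij_betw[OF bij_betw_split_matching[OF fin(1,2), of M j], of "\<lambda>F. h (cell_count F)"]
    by (simp add: R_def split_def)
  also have "\<dots> = (\<Sum>K\<in>skeleton_matchings X Y M j. \<Sum>F\<in>R K. h (cell_count (K \<union> F)))"
    using fin finR by (subst sum.Sigma) (auto simp: R_def finite_skeleton_matchings)
  also have "\<dots> = (\<Sum>K\<in>skeleton_matchings X Y M j. \<Sum>F\<in>perfect_matchings X' Y'. h' (cell_count F))"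
  proof (rule sum.cong[OF refl])
    fix K assume K: "K \<in> skeleton_matchings X Y M j"
    have "(\<Sum>F\<in>R K. h (cell_count (K \<union> F))) =
        (\<Sum>F\<in>R K. h (\<lambda>e. if e \<in> M then j e else cell_count F e))"
      using count[OF K] by (intro sum.cong) auto
    also have "\<dots> = (\<Sum>F\<in>perfect_matchings (X - fst ` K) (Y - snd ` K). h' (cell_count F))"
      unfolding R_def h'_def using finR by (subst sum.inter_filter) auto
    also have "\<dots> = (\<Sum>F\<in>perfect_matchings X' Y'. h' (cell_count F))"
      using fin card_residual_fibre[OF K fin(1,2,5)] X' Y'
      by (intro sum_perfect_matchings_relabel) auto
    finally show "(\<Sum>F\<in>R K. h (cell_count (K \<union> F))) = \<dots>" .
  qed
  also have "\<dots> = card (skeleton_matchings X Y M j) * (\<Sum>F\<in>perfect_matchings X' Y'. h' (cell_count F))"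
    by simp
  also have "(\<Sum>F\<in>perfect_matchings X' Y'. h' (cell_count F)) =
     (\<Sum>F | F \<in> perfect_matchings X' Y' \<and> (\<forall>e\<in>M. cell_count F e = 0).
        h (\<lambda>e. if e \<in> M then j e else cell_count F e))"
    unfolding h'_def using finite_perfect_matchings[OF fin(3,4)] by (subst sum.inter_filter[symmetric]) auto
  finally show ?thesis .
qed

section \<open>Marks that are constant along the edges of a graph\<close>

lemma UNIV_mark: "(UNIV :: mark set) = {Independent, Complete}"
  using mark.exhaust by auto

lemma finite_UNIV_mark [simp]: "finite (UNIV :: mark set)"
  by (simp add: UNIV_mark)

lemma card_UNIV_mark [simp]: "card (UNIV :: mark set) = 2"
  by (simp add: UNIV_mark)

text \<open>\<open>num_components\<close> counts reachability classes of non-isolated vertices only;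
  a vertex in no edge reaches only itself and adds a singleton class.\<close>

lemma card_quotient_components:
  fixes E :: "'v set set"
  assumes "finite V" "\<Union>E \<subseteq> V"
  shows "card (V // {(u, v). {u, v} \<in> E}\<^sup>*) = card (V - \<Union>E) + num_components E"
proof -
  let ?r = "{(u, v). {u, v} \<in> E}\<^sup>*"
  have out: "?r `` {v} = {v}" if "v \<notin> \<Union>E" for v
  proof -
    have "w = v" if "(v, w) \<in> ?r" for w
      using that \<open>v \<notin> \<Union>E\<close> by (induction rule: rtrancl_induct) auto
    then show ?thesis
      by auto
  qed
  have self: "v \<in> ?r `` {v}" for v
    by auto
  have "V // ?r = (V - \<Union>E) // ?r \<union> \<Union>E // ?r"
    using assms(2) by (auto simp: quotient_def)
  moreover have "(V - \<Union>E) // ?r = (\<lambda>v. {v}) ` (V - \<Union>E)"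
    using out by (auto simp: quotient_def)
  moreover have "(\<lambda>v. {v}) ` (V - \<Union>E) \<inter> \<Union>E // ?r = {}"
  proof (rule equals0I)
    fix C assume "C \<in> (\<lambda>v. {v}) ` (V - \<Union>E) \<inter> \<Union>E // ?r"
    then obtain v w where "v \<notin> \<Union>E" "w \<in> \<Union>E" "C = {v}" "C = ?r `` {w}"
      by (auto simp: quotient_def)
    then show False
      using self[of w] by auto
  qed
  moreover have "finite (\<Union>E // ?r)"
    unfolding quotient_def using finite_subset[OF assms(2,1)] by (intro finite_UN_I) auto
  ultimately have "card (V // ?r) = card ((\<lambda>v. {v}) ` (V - \<Union>E)) + card (\<Union>E // ?r)"
    using assms(1) by (simp add: card_Un_disjoint)
  then show ?thesis
    by (simp add: card_image num_components_def)
qed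

text \<open>Such marks are constant on reachability classes, hence correspond to arbitrary functions
  on the quotient, with two values for each class.\<close>

lemma card_constant_marks:
  fixes E :: "'v set set"
  assumes "finite V" "\<Union>E \<subseteq> V"
  shows "card {f \<in> V \<rightarrow>\<^sub>E (UNIV :: mark set). \<forall>u v. {u, v} \<in> E \<longrightarrow> f u = f v} =
           2 ^ (card (V - \<Union>E) + num_components E)"
proof -
  define r where "r = {(u, v). {u, v} \<in> E}\<^sup>*"
  let ?F = "{f \<in> V \<rightarrow>\<^sub>E (UNIV :: mark set). \<forall>u v. {u, v} \<in> E \<longrightarrow> f u = f v}"
  have "sym {(u, v). {u, v} \<in> E}"
    by (auto simp: sym_def insert_commute)
  then have eq: "equiv UNIV r"
    unfolding r_def by (intro equivI) (auto simp: refl_on_def intro: sym_rtrancl trans_rtrancl)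
  have closed: "v \<in> V" if "(u, v) \<in> r" "u \<in> V" for u v
    using that unfolding r_def by (induction rule: rtrancl_induct) (use assms in auto)
  have const: "f u = f v" if "f \<in> ?F" "(u, v) \<in> r" for f u v
    using that(2) unfolding r_def by (induction rule: rtrancl_induct) (use that(1) in auto)
  have "bij_betw (\<lambda>q. \<lambda>v\<in>V. q (r `` {v})) ((V // r) \<rightarrow>\<^sub>E (UNIV :: mark set)) ?F"
    unfolding bij_betw_def
  proof
    show "inj_on (\<lambda>q. \<lambda>v\<in>V. q (r `` {v})) ((V // r) \<rightarrow>\<^sub>E (UNIV :: mark set))"
    proof (rule inj_onI)
      fix p q :: "'v set \<Rightarrow> mark"
      assume p: "p \<in> (V // r) \<rightarrow>\<^sub>E UNIV" and q: "q \<in> (V // r) \<rightarrow>\<^sub>E UNIV"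
        and pq: "(\<lambda>v\<in>V. p (r `` {v})) = (\<lambda>v\<in>V. q (r `` {v}))"
      show "p = q"
      proof (rule PiE_ext[OF p q])
        fix C assume "C \<in> V // r"
        then obtain v where "v \<in> V" "C = r `` {v}"
          by (auto simp: quotient_def)
        then show "p C = q C"
          using fun_cong[OF pq, of v] by simp
      qed
    qed
    show "(\<lambda>q. \<lambda>v\<in>V. q (r `` {v})) ` ((V // r) \<rightarrow>\<^sub>E (UNIV :: mark set)) = ?F"
    proof (intro equalityI subsetI)
      fix f assume "f \<in> (\<lambda>q. \<lambda>v\<in>V. q (r `` {v})) ` ((V // r) \<rightarrow>\<^sub>E (UNIV :: mark set))"
      then obtain q where f: "f = (\<lambda>v\<in>V. q (r `` {v}))"
        by blast
      have "f u = f v" if "{u, v} \<in> E" for u v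
      proof -
        have "(u, v) \<in> r"
          using that unfolding r_def by auto
        then have "r `` {u} = r `` {v}"
          using eq by (simp add: equiv_class_eq)
        moreover have "u \<in> V" "v \<in> V"
          using that assms(2) by auto
        ultimately show ?thesis
          by (simp add: f)
      qed
      then show "f \<in> ?F"
        by (simp add: f)
    next
      fix f assume f: "f \<in> ?F"
      \<comment> \<open>A class takes the mark of an arbitrary representative; by
        \<open>const\<close> the choice does not matter.\<close>
      define q where "q = (\<lambda>C\<in>V // r. f (SOME v. v \<in> C))"
      have "(\<lambda>v\<in>V. q (r `` {v})) = f"
      proof (rule PiE_ext[of _ V "\<lambda>_. UNIV"])
        show "f \<in> V \<rightarrow>\<^sub>E UNIV"
          using f by simp
        fix v assume v: "v \<in> V"
        have "v \<in> r `` {v}"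
          by (simp add: r_def)
        then have "(SOME u. u \<in> r `` {v}) \<in> r `` {v}"
          by (rule someI)
        then have "f (SOME u. u \<in> r `` {v}) = f v"
          using const[OF f, of v] by (auto simp: Image_singleton_iff)
        then show "(\<lambda>v\<in>V. q (r `` {v})) v = f v"
          using v by (simp add: q_def quotientI)
      qed auto
      moreover have "q \<in> (V // r) \<rightarrow>\<^sub>E UNIV"
        by (simp add: q_def)
      ultimately show "f \<in> (\<lambda>q. \<lambda>v\<in>V. q (r `` {v})) ` ((V // r) \<rightarrow>\<^sub>E (UNIV :: mark set))"
        by (rule image_eqI[OF sym])
    qed
  qed
  then have "card ?F = card ((V // r) \<rightarrow>\<^sub>E (UNIV :: mark set))"
    by (simp add: bij_betw_same_card)
  also have "\<dots> = 2 ^ card (V // r)"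
    using assms(1) by (simp add: card_PiE quotient_def)
  finally show ?thesis
    using card_quotient_components[OF assms] by (simp add: r_def)
qed

section \<open>Signed classes in the random graph\<close>

definition pairs :: "nat set \<Rightarrow> nat set set" where
  "pairs C = {e. e \<subseteq> C \<and> card e = 2}"

lemma pairs_Int: "pairs C \<inter> pairs D = pairs (C \<inter> D)"
  by (auto simp: pairs_def)

lemma finite_pairs: "finite C \<Longrightarrow> finite (pairs C)"
  by (simp add: pairs_def)

lemma card_pairs: "finite C \<Longrightarrow> card (pairs C) = card C choose 2"
  by (simp add: pairs_def n_subsets)

lemma pairs_eq_empty_iff: "finite C \<Longrightarrow> pairs C = {} \<longleftrightarrow> card C < 2"
  by (simp add: card_pairs finite_pairs flip: card_0_eq)

definition mark_ok :: "(nat set \<Rightarrow> bool) \<Rightarrow> mark \<Rightarrow> nat set \<Rightarrow> bool" where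
  "mark_ok G m C \<longleftrightarrow> (m = Independent \<longrightarrow> edgeless_on G C) \<and> (m = Complete \<longrightarrow> complete_on G C)"

lemma ball_pairs: "(\<forall>e\<in>pairs C. P e) \<longleftrightarrow> (\<forall>u\<in>C. \<forall>v\<in>C. u \<noteq> v \<longrightarrow> P {u, v})"
proof
  assume *: "\<forall>e\<in>pairs C. P e"
  have "{u, v} \<in> pairs C" if "u \<in> C" "v \<in> C" "u \<noteq> v" for u v
    using that by (simp add: pairs_def)
  with * show "\<forall>u\<in>C. \<forall>v\<in>C. u \<noteq> v \<longrightarrow> P {u, v}"
    by blast
qed (auto simp: pairs_def card_2_iff)

text \<open>A mark prescribes the value of \<open>G\<close> at every pair inside the class, so
  events about marks become cylinder events. A class with fewer than two vertices imposes nothing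
  and admits both marks.\<close>

lemma mark_ok_iff: "mark_ok G m C \<longleftrightarrow> (\<forall>e\<in>pairs C. G e \<longleftrightarrow> m = Complete)"
  by (cases m) (simp_all add: mark_ok_def edgeless_on_def complete_on_def ball_pairs)

lemma finite_all_edges: "finite (all_edges n)"
  by (simp add: all_edges_def)

lemma prob_random_graph:
  assumes "A \<subseteq> all_edges n"
  shows "measure_pmf.prob (random_graph n) {G. \<forall>e\<in>A. G e = v e} = (1 / 2) ^ card A"
proof -
  let ?B = "\<lambda>e. if e \<in> A then {v e} else UNIV"
  have "{G. \<forall>e\<in>A. G e = v e} = Pi (all_edges n) ?B"
    using assms by (auto simp: Pi_def)
  then have "measure_pmf.prob (random_graph n) {G. \<forall>e\<in>A. G e = v e} =
      (\<Prod>e\<in>all_edges n. measure_pmf.prob (bernoulli_pmf (1 / 2)) (?B e))"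
    by (simp add: random_graph_def measure_Pi_pmf_Pi finite_all_edges)
  also have "\<dots> = (\<Prod>e\<in>all_edges n. if e \<in> A then 1 / 2 else 1)"
  proof (rule prod.cong[OF refl])
    fix e
    show "measure_pmf.prob (bernoulli_pmf (1 / 2)) (?B e) = (if e \<in> A then 1 / 2 else 1)"
      by (cases "v e") (simp_all add: measure_pmf_single)
  qed
  also have "\<dots> = (1 / 2) ^ card A"
    using assms finite_all_edges[of n] by (simp add: prod.If_cases Int_absorb1)
  finally show ?thesis .
qed

text \<open>Two classes with at least two common vertices share a pair whose value both marks
  prescribe: different marks contradict each other and the event is empty. If all such marks agree,
  the prescriptions form one assignment on the union of the pairs.\<close>

lemma prob_marks_ok:
  fixes C :: "'i \<Rightarrow> nat set"
  assumes sub: "\<And>i. i \<in> I \<Longrightarrow> C i \<subseteq> {1..n}"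
  shows "measure_pmf.prob (random_graph n) {G. \<forall>i\<in>I. mark_ok G (\<sigma> i) (C i)} =
    (if \<forall>i\<in>I. \<forall>j\<in>I. card (C i \<inter> C j) \<ge> 2 \<longrightarrow> \<sigma> i = \<sigma> j
     then (1 / 2) ^ card (\<Union>i\<in>I. pairs (C i)) else 0)"
proof -
  have meet: "card (C i \<inter> C j) \<ge> 2 \<longleftrightarrow> pairs (C i) \<inter> pairs (C j) \<noteq> {}" if "i \<in> I" for i j
  proof -
    have "finite (C i \<inter> C j)"
      using sub[OF that] by (auto intro: finite_subset)
    then show ?thesis
      by (simp add: pairs_Int pairs_eq_empty_iff not_less)
  qed
  show ?thesis
  proof (cases "\<forall>i\<in>I. \<forall>j\<in>I. card (C i \<inter> C j) \<ge> 2 \<longrightarrow> \<sigma> i = \<sigma> j")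
    case True
    define v where "v e \<longleftrightarrow> (\<exists>i\<in>I. e \<in> pairs (C i) \<and> \<sigma> i = Complete)" for e
    have v: "v e \<longleftrightarrow> \<sigma> i = Complete" if "i \<in> I" "e \<in> pairs (C i)" for i e
    proof -
      have "\<sigma> j = \<sigma> i" if "j \<in> I" "e \<in> pairs (C j)" for j
        using True meet[of j i] that \<open>i \<in> I\<close> \<open>e \<in> pairs (C i)\<close> by blast
      then show ?thesis
        using that unfolding v_def by metis
    qed
    have "{G. \<forall>i\<in>I. mark_ok G (\<sigma> i) (C i)} = {G. \<forall>e\<in>(\<Union>i\<in>I. pairs (C i)). G e = v e}"
      using v by (auto simp: mark_ok_iff)
    moreover have "(\<Union>i\<in>I. pairs (C i)) \<subseteq> all_edges n"
      using sub by (force simp: pairs_def all_edges_def)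
    ultimately show ?thesis
      using True prob_random_graph[of "\<Union>i\<in>I. pairs (C i)" n v] by simp
  next
    case False
    then obtain i j e where ij: "i \<in> I" "j \<in> I" "\<sigma> i \<noteq> \<sigma> j" "e \<in> pairs (C i)" "e \<in> pairs (C j)"
      using meet by blast
    have "{G. \<forall>i\<in>I. mark_ok G (\<sigma> i) (C i)} = {}"
    proof (rule equals0I)
      fix G assume "G \<in> {G. \<forall>i\<in>I. mark_ok G (\<sigma> i) (C i)}"
      then have "G e \<longleftrightarrow> \<sigma> i = Complete" "G e \<longleftrightarrow> \<sigma> j = Complete"
        using ij by (auto simp: mark_ok_iff)
      then show False
        using ij(3) by (metis mark.exhaust)
    qed
    then show ?thesis
      by (simp only: measure_empty False if_False)
  qed
qed

text \<open>The classes form an indexed family rather than a set: classes of two partitions may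
  coincide and then still carry two marks.\<close>

definition mark_count :: "(nat set \<Rightarrow> bool) \<Rightarrow> 'i set \<Rightarrow> ('i \<Rightarrow> nat set) \<Rightarrow> nat" where
  "mark_count G I C = card {\<sigma> \<in> I \<rightarrow>\<^sub>E UNIV. \<forall>i\<in>I. mark_ok G (\<sigma> i) (C i)}"

text \<open>By linearity over the marks: compatible families all have the same probability,
  incompatible ones contribute 0. Compatibility is constancy along the edges of \<open>E\<close>, so
  the compatible families are counted by components and isolated indices. The graph is a parameter
  so that it can be supplied as a \<open>cell_graph\<close>.\<close>

lemma expectation_mark_count:
  fixes C :: "'i \<Rightarrow> nat set"
  assumes sub: "\<And>i. i \<in> I \<Longrightarrow> C i \<subseteq> {1..n}" and fin: "finite I"
    and E: "E = {{i, j} | i j. i \<in> I \<and> j \<in> I \<and> i \<noteq> j \<and> card (C i \<inter> C j) \<ge> 2}"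
  shows "measure_pmf.expectation (random_graph n) (\<lambda>G. real (mark_count G I C)) =
    2 ^ (card (I - \<Union>E) + num_components E) * (1 / 2) ^ card (\<Union>i\<in>I. pairs (C i))"
proof -
  let ?P = "I \<rightarrow>\<^sub>E (UNIV :: mark set)"
  have finP: "finite ?P"
    using fin by (intro finite_PiE) auto
  have count: "real (mark_count G I C) = (\<Sum>\<sigma>\<in>?P. indicator {G. \<forall>i\<in>I. mark_ok G (\<sigma> i) (C i)} G)" for G
    using finP by (simp add: mark_count_def indicator_def Int_def)
  have compat: "(\<forall>i\<in>I. \<forall>j\<in>I. card (C i \<inter> C j) \<ge> 2 \<longrightarrow> \<sigma> i = \<sigma> j) \<longleftrightarrow>
      (\<forall>u v. {u, v} \<in> E \<longrightarrow> \<sigma> u = \<sigma> v)" for \<sigma> :: "'i \<Rightarrow> mark"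
  proof
    assume *: "\<forall>i\<in>I. \<forall>j\<in>I. card (C i \<inter> C j) \<ge> 2 \<longrightarrow> \<sigma> i = \<sigma> j"
    show "\<forall>u v. {u, v} \<in> E \<longrightarrow> \<sigma> u = \<sigma> v"
      using * by (auto simp: E doubleton_eq_iff)
  next
    assume *: "\<forall>u v. {u, v} \<in> E \<longrightarrow> \<sigma> u = \<sigma> v"
    show "\<forall>i\<in>I. \<forall>j\<in>I. card (C i \<inter> C j) \<ge> 2 \<longrightarrow> \<sigma> i = \<sigma> j"
    proof (intro ballI impI)
      fix i j assume "i \<in> I" "j \<in> I" "card (C i \<inter> C j) \<ge> 2"
      then show "\<sigma> i = \<sigma> j"
        using * unfolding E by (cases "i = j") blast+
    qed
  qed
  have "measure_pmf.expectation (random_graph n) (\<lambda>G. real (mark_count G I C)) =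
      (\<Sum>\<sigma>\<in>?P. measure_pmf.prob (random_graph n) {G. \<forall>i\<in>I. mark_ok G (\<sigma> i) (C i)})"
    unfolding count by (subst Bochner_Integration.integral_sum) (auto simp: measure_pmf.emeasure_eq_measure)
  also have "\<dots> = (\<Sum>\<sigma>\<in>?P. if \<forall>u v. {u, v} \<in> E \<longrightarrow> \<sigma> u = \<sigma> v
      then (1 / 2) ^ card (\<Union>i\<in>I. pairs (C i)) else 0)"
    using sub by (intro sum.cong refl) (simp add: prob_marks_ok compat)
  also have "\<dots> = card {\<sigma> \<in> ?P. \<forall>u v. {u, v} \<in> E \<longrightarrow> \<sigma> u = \<sigma> v} * (1 / 2) ^ card (\<Union>i\<in>I. pairs (C i))"
    using finP by (simp flip: sum.inter_filter)
  also have "card {\<sigma> \<in> ?P. \<forall>u v. {u, v} \<in> E \<longrightarrow> \<sigma> u = \<sigma> v} = 2 ^ (card (I - \<Union>E) + num_components E)"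
    using fin by (intro card_constant_marks) (auto simp: E)
  finally show ?thesis
    by simp
qed

section \<open>Labelings of the vertices by stubs\<close>

definition stubs :: "nat \<Rightarrow> (nat \<Rightarrow> nat) \<Rightarrow> stub set" where
  "stubs n k = Sigma (slots k) (\<lambda>a. {..<slot_size n a})"

definition block :: "nat \<Rightarrow> slot \<Rightarrow> stub set" where
  "block n a = {a} \<times> {..<slot_size n a}"

definition labelings :: "nat \<Rightarrow> (nat \<Rightarrow> nat) \<Rightarrow> (stub \<Rightarrow> nat) set" where
  "labelings n k = bijections (stubs n k) {1..n}"

definition classes :: "nat \<Rightarrow> (nat \<Rightarrow> nat) \<Rightarrow> (stub \<Rightarrow> nat) \<Rightarrow> nat set set" where
  "classes n k \<phi> = (\<lambda>a. \<phi> ` block n a) ` slots k"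

definition profile_partitions :: "nat \<Rightarrow> (nat \<Rightarrow> nat) \<Rightarrow> nat set set set" where
  "profile_partitions n k = {P. partition_on {1..n} P \<and>
     (\<forall>i\<in>{2..5}. card {C \<in> P. int (card C) = alpha n - int i} = k i)}"

lemma finite_stubs: "finite (stubs n k)"
  by (simp add: stubs_def finite_slots)

lemma finite_labelings: "finite (labelings n k)"
  by (simp add: labelings_def finite_bijections finite_stubs)

lemma finite_profile_partitions: "finite (profile_partitions n k)"
  by (rule finite_subset[of _ "Pow (Pow {1..n})"]) (auto simp: profile_partitions_def partition_on_def)

lemma card_block [simp]: "card (block n a) = slot_size n a"
  by (simp add: block_def card_cartesian_product_singleton)

lemma finite_block [simp]: "finite (block n a)"
  by (simp add: block_def)

lemma block_disjoint: "a \<noteq> b \<Longrightarrow> block n a \<inter> block n b = {}"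
  by (auto simp: block_def)

lemma stubs_eq_UN: "stubs n k = (\<Union>a\<in>slots k. block n a)"
  by (auto simp: stubs_def block_def)

lemma block_subset: "a \<in> slots k \<Longrightarrow> block n a \<subseteq> stubs n k"
  by (auto simp: stubs_eq_UN)

lemma stubs_fibre: "a \<in> slots k \<Longrightarrow> {x \<in> stubs n k. fst x = a} = block n a"
  by (auto simp: stubs_def block_def)

lemma card_slots_fst: "i \<in> {2..5} \<Longrightarrow> card {a \<in> slots k. fst a = i} = k i"
proof -
  assume "i \<in> {2..5}"
  then have "{a \<in> slots k. fst a = i} = Pair i ` {..<k i}"
    by (auto simp: slots_def)
  then show ?thesis
    by (simp add: card_image inj_on_def)
qed

section \<open>Labelings of a feasible profile\<close>

context
  fixes n :: nat and k :: "nat \<Rightarrow> nat"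
  assumes feasible: "feasible_profile n k"
begin

text \<open>By feasibility only indices of positive size have slots, so the conversion
  \<open>nat\<close> in \<open>slot_size\<close> loses nothing.\<close>

lemma int_slot_size: "a \<in> slots k \<Longrightarrow> int (slot_size n a) = alpha n - int (fst a)"
  and slot_size_pos: "a \<in> slots k \<Longrightarrow> slot_size n a > 0"
proof -
  assume "a \<in> slots k"
  then have "fst a \<in> {2..5}" "k (fst a) \<noteq> 0"
    by (auto simp: slots_def)
  then have "alpha n - int (fst a) > 0"
    using feasible unfolding feasible_profile_def by (metis not_le)
  then show "int (slot_size n a) = alpha n - int (fst a)" "slot_size n a > 0"
    by (auto simp: slot_size_def)
qed

lemma card_slots_size:
  assumes "i \<in> {2..5}"
  shows "card {a \<in> slots k. int (slot_size n a) = alpha n - int i} = k i"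
proof -
  have "{a \<in> slots k. int (slot_size n a) = alpha n - int i} = {a \<in> slots k. fst a = i}"
    using int_slot_size by auto
  then show ?thesis
    using card_slots_fst[OF assms] by simp
qed

lemma card_stubs: "card (stubs n k) = n"
proof -
  have "int (card (stubs n k)) = (\<Sum>a\<in>slots k. int (slot_size n a))"
    by (simp add: stubs_def finite_slots)
  also have "\<dots> = (\<Sum>a\<in>slots k. alpha n - int (fst a))"
    using int_slot_size by simp
  also have "\<dots> = (\<Sum>i\<in>{2..5}. \<Sum>l<k i. alpha n - int i)"
    unfolding slots_def by (subst sum.Sigma) (auto simp: split_def)
  also have "\<dots> = (\<Sum>i\<in>{2..5}. (alpha n - int i) * int (k i))"
    by (simp add: mult.commute)
  finally show ?thesis
    using feasible by (simp add: feasible_profile_def)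
qed

lemma labeling_inj: "\<phi> \<in> labelings n k \<Longrightarrow> inj_on \<phi> (stubs n k)"
  and labeling_image: "\<phi> \<in> labelings n k \<Longrightarrow> \<phi> ` stubs n k = {1..n}"
  by (auto simp: labelings_def bijections_def bij_betw_def)

lemma card_labeling_block:
  "\<phi> \<in> labelings n k \<Longrightarrow> a \<in> slots k \<Longrightarrow> card (\<phi> ` block n a) = slot_size n a"
  using card_image[OF inj_on_subset[OF labeling_inj block_subset]] by simp

lemma labeling_blocks_disjoint:
  assumes "\<phi> \<in> labelings n k" "a \<in> slots k" "b \<in> slots k" "a \<noteq> b"
  shows "\<phi> ` block n a \<inter> \<phi> ` block n b = {}"
  using inj_on_image_Int[OF labeling_inj[OF assms(1)] block_subset block_subset, of a b] assms block_disjoint[of a b n]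
  by auto

lemma labeling_block_nonempty: "\<phi> \<in> labelings n k \<Longrightarrow> a \<in> slots k \<Longrightarrow> \<phi> ` block n a \<noteq> {}"
  using card_labeling_block[of \<phi> a] slot_size_pos[of a] by auto

lemma labeling_block_inj: "\<phi> \<in> labelings n k \<Longrightarrow> inj_on (\<lambda>a. \<phi> ` block n a) (slots k)"
  by (rule inj_onI) (metis labeling_blocks_disjoint labeling_block_nonempty Int_absorb)

lemma classes_in_profile_partitions:
  assumes \<phi>: "\<phi> \<in> labelings n k"
  shows "classes n k \<phi> \<in> profile_partitions n k"
proof -
  have "\<Union>(classes n k \<phi>) = {1..n}"
    using labeling_image[OF \<phi>] by (simp add: classes_def stubs_eq_UN image_UN)
  moreover have "disjnt p q" if "p \<in> classes n k \<phi>" "q \<in> classes n k \<phi>" "p \<noteq> q" for p q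
    using that labeling_blocks_disjoint[OF \<phi>] unfolding classes_def disjnt_def by blast
  moreover have "{} \<notin> classes n k \<phi>"
    using labeling_block_nonempty[OF \<phi>] unfolding classes_def by blast
  ultimately have "partition_on {1..n} (classes n k \<phi>)"
    by (intro partition_onI) auto
  moreover have "card {C \<in> classes n k \<phi>. int (card C) = alpha n - int i} = k i" if "i \<in> {2..5}" for i
  proof -
    have "{C \<in> classes n k \<phi>. int (card C) = alpha n - int i} =
        (\<lambda>a. \<phi> ` block n a) ` {a \<in> slots k. int (slot_size n a) = alpha n - int i}"
      using card_labeling_block[OF \<phi>] by (auto simp: classes_def)
    moreover have "inj_on (\<lambda>a. \<phi> ` block n a) {a \<in> slots k. int (slot_size n a) = alpha n - int i}"
      by (rule inj_on_subset[OF labeling_block_inj[OF \<phi>]]) auto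
    ultimately show ?thesis
      using card_slots_size[OF that] by (simp add: card_image)
  qed
  ultimately show ?thesis
    by (simp add: profile_partitions_def)
qed

text \<open>\<open>profile_partitions\<close> fixes only the numbers of classes of the four sizes.
  By feasibility those classes already have n vertices in total, so a class of any other size would
  be empty.\<close>

lemma profile_partition_sizes:
  assumes P: "P \<in> profile_partitions n k" and C: "C \<in> P"
  shows "\<exists>i\<in>{2..5}. int (card C) = alpha n - int i"
proof (rule ccontr)
  assume no: "\<not> (\<exists>i\<in>{2..5}. int (card C) = alpha n - int i)"
  have part: "partition_on {1..n} P"
    and num: "\<And>i. i \<in> {2..5} \<Longrightarrow> card {C \<in> P. int (card C) = alpha n - int i} = k i"
    using P by (auto simp: profile_partitions_def)
  have finP: "finite P"
    using part by (auto simp: partition_on_def intro: finite_UnionD)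
  have finC: "finite D" if "D \<in> P" for D
    using part that by (auto simp: partition_on_def intro: finite_subset[of D "\<Union>P"])
  let ?Q = "\<lambda>i. {D \<in> P. int (card D) = alpha n - int i}"
  have "card (\<Union>P) = (\<Sum>D\<in>P. card D)"
    using part finC by (intro card_Union_disjoint) (auto simp: partition_on_def disjoint_def pairwise_def disjnt_def)
  then have total: "(\<Sum>D\<in>P. int (card D)) = int n"
    using part by (simp add: partition_on_def flip: of_nat_sum)
  have "(\<Sum>D\<in>(\<Union>i\<in>{2..5}. ?Q i). int (card D)) = (\<Sum>i\<in>{2..5}. \<Sum>D\<in>?Q i. int (card D))"
    using finP by (intro sum.UNION_disjoint) auto
  also have "\<dots> = (\<Sum>i\<in>{2..5}. (alpha n - int i) * int (k i))"
    using num by (intro sum.cong refl) (simp add: mult.commute)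
  also have "\<dots> = int n"
    using feasible by (simp add: feasible_profile_def)
  finally have four: "(\<Sum>D\<in>(\<Union>i\<in>{2..5}. ?Q i). int (card D)) = int n" .
  have "(\<Sum>D\<in>insert C (\<Union>i\<in>{2..5}. ?Q i). int (card D)) \<le> (\<Sum>D\<in>P. int (card D))"
    using finP C by (intro sum_mono2) auto
  moreover have "C \<notin> (\<Union>i\<in>{2..5}. ?Q i)"
    using no by auto
  moreover have "finite (\<Union>i\<in>{2..5}. ?Q i)"
    using finP by auto
  ultimately have "card C = 0"
    using four total by simp
  then show False
    using finC[OF C] part C by (auto simp: partition_on_def)
qed

text \<open>Two fibrewise bijections: slots correspond to classes of the same size, and the stubs of
  each slot to the vertices of its class.\<close>

lemma classes_surj:
  assumes P: "P \<in> profile_partitions n k"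
  shows "\<exists>\<phi>\<in>labelings n k. classes n k \<phi> = P"
proof -
  have part: "partition_on {1..n} P"
    and num: "\<And>i. i \<in> {2..5} \<Longrightarrow> card {C \<in> P. int (card C) = alpha n - int i} = k i"
    using P by (auto simp: profile_partitions_def)
  have finP: "finite P"
    using part by (auto simp: partition_on_def intro: finite_UnionD)
  \<comment> \<open>For \<open>c\<close> outside the four sizes both sets are empty; on the side of
    \<open>P\<close> this is \<open>profile_partition_sizes\<close>.\<close>
  have "card {a \<in> slots k. int (slot_size n a) = c} = card {C \<in> P. int (card C) = c}" for c
  proof (cases "\<exists>i\<in>{2..5}. c = alpha n - int i")
    case True
    then show ?thesis
      using num card_slots_size by auto
  next
    case False
    then have "{a \<in> slots k. int (slot_size n a) = c} = {}"
      using int_slot_size by (auto simp: slots_def)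
    moreover have "{C \<in> P. int (card C) = c} = {}"
      using False profile_partition_sizes[OF P] by auto
    ultimately show ?thesis
      by (simp only: card.empty)
  qed
  then obtain b where b: "bij_betw b (slots k) P"
    and card_b: "\<And>a. a \<in> slots k \<Longrightarrow> int (card (b a)) = int (slot_size n a)"
    using fibrewise_bijection[of "slots k" P "\<lambda>a. int (slot_size n a)" "\<lambda>C. int (card C)"] finP finite_slots
    by metis
  have cover: "(\<Union>a\<in>slots k. b a) = {1..n}"
    using b part by (auto simp: bij_betw_def partition_on_def)
  have disj: "a = a'" if "a \<in> slots k" "a' \<in> slots k" "x \<in> b a" "x \<in> b a'" for a a' x
  proof -
    have "b a \<in> P" "b a' \<in> P"
      using b that by (auto simp: bij_betw_def)
    then have "b a = b a'"
      using that part unfolding partition_on_def disjoint_def by blast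
    then show ?thesis
      using b that by (auto simp: bij_betw_def inj_on_def)
  qed
  \<comment> \<open>The slot whose class contains \<open>x\<close>. A bijection from stubs to
    vertices that respects \<open>slot_of\<close> sends the block of each slot onto its
    class.\<close>
  define slot_of where "slot_of x = (THE a. a \<in> slots k \<and> x \<in> b a)" for x
  have slot_of: "slot_of x = a" if "a \<in> slots k" "x \<in> b a" for x a
    unfolding slot_of_def by (rule the_equality) (use that disj in blast)+
  have slot_of_slots: "slot_of x \<in> slots k \<and> x \<in> b (slot_of x)" if x: "x \<in> {1..n}" for x
  proof -
    obtain a where "a \<in> slots k" "x \<in> b a"
      using x unfolding cover[symmetric] by blast
    then show ?thesis
      using slot_of by simp
  qed
  have fibre: "{x \<in> {1..n}. slot_of x = a} = b a" if "a \<in> slots k" for a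
  proof (intro set_eqI iffI)
    fix x assume "x \<in> {x \<in> {1..n}. slot_of x = a}"
    then show "x \<in> b a"
      using slot_of_slots[of x] by simp
  next
    fix x assume x: "x \<in> b a"
    then have "x \<in> (\<Union>a\<in>slots k. b a)"
      using that by blast
    then show "x \<in> {x \<in> {1..n}. slot_of x = a}"
      using slot_of[OF that x] unfolding cover by simp
  qed
  have "card {x \<in> stubs n k. fst x = a} = card {x \<in> {1..n}. slot_of x = a}" for a
  proof (cases "a \<in> slots k")
    case True
    then show ?thesis
      unfolding fibre[OF True] stubs_fibre[OF True] using card_b[OF True] by simp
  next
    case False
    then have "{x \<in> stubs n k. fst x = a} = {}" "{x \<in> {1..n}. slot_of x = a} = {}"
      using slot_of_slots by (auto simp: stubs_def)
    then show ?thesis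
      by (simp only: card.empty)
  qed
  then obtain \<psi> where \<psi>: "bij_betw \<psi> (stubs n k) {1..n}" "\<And>x. x \<in> stubs n k \<Longrightarrow> slot_of (\<psi> x) = fst x"
    using fibrewise_bijection[of "stubs n k" "{1..n}" fst slot_of] finite_stubs by blast
  have "\<psi> ` block n a = b a" if a: "a \<in> slots k" for a
  proof
    show "\<psi> ` block n a \<subseteq> b a"
    proof
      fix y assume "y \<in> \<psi> ` block n a"
      then obtain x where x: "x \<in> block n a" "y = \<psi> x"
        by blast
      then have "x \<in> stubs n k" "fst x = a"
        using block_subset[OF a] by (auto simp: block_def)
      then have "y \<in> {x \<in> {1..n}. slot_of x = a}"
        using \<psi> x(2) by (auto simp: bij_betw_def)
      then show "y \<in> b a"
        by (simp only: fibre[OF a])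
    qed
    show "b a \<subseteq> \<psi> ` block n a"
    proof
      fix y assume "y \<in> b a"
      then have "y \<in> {1..n}" "slot_of y = a"
        using fibre[OF a] by blast+
      then have "y \<in> \<psi> ` stubs n k"
        using bij_betw_imp_surj_on[OF \<psi>(1)] by simp
      then obtain x where x: "x \<in> stubs n k" "y = \<psi> x"
        by blast
      then have "x \<in> {x \<in> stubs n k. fst x = a}"
        using \<psi>(2)[OF x(1)] \<open>slot_of y = a\<close> by simp
      then have "x \<in> block n a"
        by (simp only: stubs_fibre[OF a])
      with x(2) show "y \<in> \<psi> ` block n a"
        by blast
    qed
  qed
  moreover have "restrict \<psi> (stubs n k) ` block n a = \<psi> ` block n a" if "a \<in> slots k" for a
    using block_subset[OF that, of n] by (intro image_cong refl) auto
  ultimately have "restrict \<psi> (stubs n k) ` block n a = b a" if "a \<in> slots k" for a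
    using that by simp
  then have "classes n k (restrict \<psi> (stubs n k)) = P"
    using b by (simp add: classes_def bij_betw_def)
  moreover have "restrict \<psi> (stubs n k) \<in> labelings n k"
    using \<psi>(1) by (auto simp: labelings_def bijections_def bij_betw_def)
  ultimately show ?thesis
    by blast
qed

text \<open>A permutation \<pi> of the vertices that carries a labeling of \<open>P\<close> to one
  of \<open>Q\<close> acts on labelings by composition. The action is injective and sends labelings
  of \<open>P\<close> to labelings of \<open>Q\<close>; exchanging \<open>P\<close> and
  \<open>Q\<close> gives equality.\<close>

lemma card_labelings_le:
  assumes P: "P \<in> profile_partitions n k" and Q: "Q \<in> profile_partitions n k"
  shows "card {\<phi> \<in> labelings n k. classes n k \<phi> = P} \<le> card {\<phi> \<in> labelings n k. classes n k \<phi> = Q}"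
proof -
  obtain \<phi>0 \<phi>1 where \<phi>0: "\<phi>0 \<in> labelings n k" "classes n k \<phi>0 = P"
    and \<phi>1: "\<phi>1 \<in> labelings n k" "classes n k \<phi>1 = Q"
    using classes_surj[OF P] classes_surj[OF Q] by blast
  define \<pi> where "\<pi> = \<phi>1 \<circ> inv_into (stubs n k) \<phi>0"
  have bij0: "bij_betw \<phi>0 (stubs n k) {1..n}" and bij1: "bij_betw \<phi>1 (stubs n k) {1..n}"
    using \<phi>0 \<phi>1 by (simp_all add: labelings_def bijections_def)
  have \<pi>: "bij_betw \<pi> {1..n} {1..n}"
    unfolding \<pi>_def using bij_betw_trans[OF bij_betw_inv_into[OF bij0] bij1] .
  have \<pi>0: "\<pi> (\<phi>0 x) = \<phi>1 x" if "x \<in> stubs n k" for x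
    using that bij0 by (simp add: \<pi>_def bij_betw_def)
  have blk: "restrict (\<pi> \<circ> \<phi>) (stubs n k) ` block n a = \<pi> ` \<phi> ` block n a" if "a \<in> slots k" for \<phi> a
    using block_subset[OF that, of n] unfolding image_comp by (intro image_cong refl) auto
  have cl: "classes n k (restrict (\<pi> \<circ> \<phi>) (stubs n k)) = (`) \<pi> ` classes n k \<phi>" for \<phi>
  proof -
    have "classes n k (restrict (\<pi> \<circ> \<phi>) (stubs n k)) = (\<lambda>a. \<pi> ` \<phi> ` block n a) ` slots k"
      unfolding classes_def by (rule image_cong[OF refl blk])
    then show ?thesis
      by (simp add: classes_def image_image)
  qed
  have "restrict (\<pi> \<circ> \<phi>0) (stubs n k) = \<phi>1"
  proof
    fix x
    have "\<phi>1 \<in> stubs n k \<rightarrow>\<^sub>E {1..n}"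
      using \<phi>1(1) by (simp add: labelings_def bijections_def)
    then have "\<phi>1 x = undefined" if "x \<notin> stubs n k"
      using that by (rule PiE_arb)
    then show "restrict (\<pi> \<circ> \<phi>0) (stubs n k) x = \<phi>1 x"
      by (cases "x \<in> stubs n k") (simp_all only: restrict_apply o_apply \<pi>0 if_True if_False simp_thms)
  qed
  with cl[of \<phi>0] have PQ: "(`) \<pi> ` P = Q"
    using \<phi>0 \<phi>1 by simp
  show ?thesis
  proof (rule card_inj_on_le[of "\<lambda>\<phi>. restrict (\<pi> \<circ> \<phi>) (stubs n k)"])
    show "inj_on (\<lambda>\<phi>. restrict (\<pi> \<circ> \<phi>) (stubs n k)) {\<phi> \<in> labelings n k. classes n k \<phi> = P}"
    proof (rule inj_onI)
      fix \<phi> \<psi> assume "\<phi> \<in> {\<phi> \<in> labelings n k. classes n k \<phi> = P}" "\<psi> \<in> {\<phi> \<in> labelings n k. classes n k \<phi> = P}"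
        and eq: "restrict (\<pi> \<circ> \<phi>) (stubs n k) = restrict (\<pi> \<circ> \<psi>) (stubs n k)"
      then have mem: "\<phi> \<in> stubs n k \<rightarrow>\<^sub>E {1..n}" "\<psi> \<in> stubs n k \<rightarrow>\<^sub>E {1..n}"
        by (simp_all add: labelings_def bijections_def)
      show "\<phi> = \<psi>"
      proof (rule PiE_ext[OF mem])
        fix x assume x: "x \<in> stubs n k"
        then have "\<pi> (\<phi> x) = \<pi> (\<psi> x)"
          using fun_cong[OF eq, of x] by simp
        then show "\<phi> x = \<psi> x"
          by (rule inj_onD[OF bij_betw_imp_inj_on[OF \<pi>] _ PiE_mem[OF mem(1) x] PiE_mem[OF mem(2) x]])
      qed
    qed
    show "(\<lambda>\<phi>. restrict (\<pi> \<circ> \<phi>) (stubs n k)) ` {\<phi> \<in> labelings n k. classes n k \<phi> = P}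
        \<subseteq> {\<phi> \<in> labelings n k. classes n k \<phi> = Q}"
    proof (rule image_subsetI)
      fix \<phi> assume \<phi>: "\<phi> \<in> {\<phi> \<in> labelings n k. classes n k \<phi> = P}"
      then have "bij_betw (\<pi> \<circ> \<phi>) (stubs n k) {1..n}"
        using bij_betw_trans[OF _ \<pi>, of \<phi> "stubs n k"] by (simp add: labelings_def bijections_def)
      then have "restrict (\<pi> \<circ> \<phi>) (stubs n k) \<in> labelings n k"
        by (auto simp: labelings_def bijections_def bij_betw_def)
      then show "restrict (\<pi> \<circ> \<phi>) (stubs n k) \<in> {\<phi> \<in> labelings n k. classes n k \<phi> = Q}"
        using cl[of \<phi>] PQ \<phi> by simp
    qed
    show "finite {\<phi> \<in> labelings n k. classes n k \<phi> = Q}"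
      using finite_labelings by auto
  qed
qed

end

section \<open>The witness count as an average over labelings\<close>

lemma mark_count_reindex:
  assumes "inj_on C I"
  shows "mark_count G (C ` I) (\<lambda>D. D) = mark_count G I C"
proof -
  have "bij_betw (\<lambda>\<sigma>. \<lambda>i\<in>I. \<sigma> (C i))
      {\<sigma> \<in> C ` I \<rightarrow>\<^sub>E UNIV. \<forall>D\<in>C ` I. mark_ok G (\<sigma> D) D} {\<sigma> \<in> I \<rightarrow>\<^sub>E UNIV. \<forall>i\<in>I. mark_ok G (\<sigma> i) (C i)}"
  proof (rule bij_betwI[where g = "\<lambda>\<sigma>. \<lambda>D\<in>C ` I. \<sigma> (inv_into I C D)"])
    show "(\<lambda>D\<in>C ` I. (\<lambda>i\<in>I. \<sigma> (C i)) (inv_into I C D)) = \<sigma>"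
      if "\<sigma> \<in> {\<sigma> \<in> C ` I \<rightarrow>\<^sub>E UNIV. \<forall>D\<in>C ` I. mark_ok G (\<sigma> D) D}" for \<sigma>
      using that assms by (intro PiE_ext[of _ "C ` I" "\<lambda>_. UNIV"]) (auto simp: inv_into_f_f)
    show "(\<lambda>i\<in>I. (\<lambda>D\<in>C ` I. \<sigma> (inv_into I C D)) (C i)) = \<sigma>"
      if "\<sigma> \<in> {\<sigma> \<in> I \<rightarrow>\<^sub>E UNIV. \<forall>i\<in>I. mark_ok G (\<sigma> i) (C i)}" for \<sigma>
      using that assms by (intro PiE_ext[of _ I "\<lambda>_. UNIV"]) (auto simp: inv_into_f_f)
  qed (use assms in \<open>auto simp: inv_into_f_f\<close>)
  then show ?thesis
    by (simp add: mark_count_def bij_betw_same_card)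
qed

lemma Z_sgn_eq: "Z_sgn n k G = (\<Sum>P\<in>profile_partitions n k. mark_count G P (\<lambda>C. C))"
proof -
  have finP: "finite P" if "P \<in> profile_partitions n k" for P
    using that by (auto simp: profile_partitions_def partition_on_def intro: finite_UnionD)
  have "{(P, \<sigma>) \<in> signed_partitions n k.
       \<forall>C\<in>P. (\<sigma> C = Independent \<longrightarrow> edgeless_on G C) \<and> (\<sigma> C = Complete \<longrightarrow> complete_on G C)} =
    Sigma (profile_partitions n k) (\<lambda>P. {\<sigma> \<in> P \<rightarrow>\<^sub>E UNIV. \<forall>C\<in>P. mark_ok G (\<sigma> C) C})"
    by (auto simp: signed_partitions_def profile_partitions_def mark_ok_def)
  then show ?thesis
    unfolding Z_sgn_def mark_count_def
    using finP by (simp add: card_SigmaI finite_profile_partitions finite_PiE)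
qed

text \<open>The constant c is the common number of labelings of a partition; it cancels in the
  moment ratio. It is positive because there are exactly n stubs, so that a labeling exists.\<close>

lemma Z_sgn_labelings:
  assumes feasible: "feasible_profile n k"
  obtains c :: nat where "c > 0"
    and "\<And>G. c * Z_sgn n k G = (\<Sum>\<phi>\<in>labelings n k. mark_count G (slots k) (\<lambda>a. \<phi> ` block n a))"
proof -
  let ?L = "\<lambda>P. {\<phi> \<in> labelings n k. classes n k \<phi> = P}"
  have "card (stubs n k) = card {1..n}"
    using card_stubs[OF feasible] by simp
  then obtain \<phi>0 where "bij_betw \<phi>0 (stubs n k) {1..n}"
    using finite_same_card_bij[of "stubs n k" "{1..n}"] finite_stubs by auto
  then have "restrict \<phi>0 (stubs n k) \<in> labelings n k"
    by (auto simp: labelings_def bijections_def bij_betw_def)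
  then obtain Q \<phi> where P0: "Q \<in> profile_partitions n k" and mem: "\<phi> \<in> ?L Q"
    using classes_in_profile_partitions[OF feasible] by blast
  have const: "card (?L P) = card (?L Q)" if "P \<in> profile_partitions n k" for P
    using card_labelings_le[OF feasible that P0] card_labelings_le[OF feasible P0 that] by simp
  show thesis
  proof (rule that[of "card (?L Q)"])
    show "card (?L Q) > 0"
      using mem finite_labelings by (auto simp: card_gt_0_iff)
    fix G
    have "(\<Sum>\<phi>\<in>labelings n k. mark_count G (slots k) (\<lambda>a. \<phi> ` block n a)) =
        (\<Sum>\<phi>\<in>labelings n k. mark_count G (classes n k \<phi>) (\<lambda>C. C))"
      unfolding classes_def
      by (intro sum.cong refl mark_count_reindex[symmetric] labeling_block_inj[OF feasible])
    also have "\<dots> = (\<Sum>P\<in>profile_partitions n k. \<Sum>\<phi>\<in>?L P. mark_count G (classes n k \<phi>) (\<lambda>C. C))"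
      using classes_in_profile_partitions[OF feasible] finite_labelings finite_profile_partitions
      by (intro sum.group[symmetric]) auto
    also have "\<dots> = (\<Sum>P\<in>profile_partitions n k. card (?L P) * mark_count G P (\<lambda>C. C))"
      by (intro sum.cong refl) simp
    also have "\<dots> = card (?L Q) * Z_sgn n k G"
      using const by (simp add: Z_sgn_eq sum_distrib_left)
    finally show "card (?L Q) * Z_sgn n k G =
        (\<Sum>\<phi>\<in>labelings n k. mark_count G (slots k) (\<lambda>a. \<phi> ` block n a))" ..
  qed
qed

section \<open>First and second moment\<close>

text \<open>A function of the cell counts alone, so that counts prescribed on a skeleton can be
  combined with those of a residual matching. When \<open>c\<close> gives the overlaps, the edges of
  the graph are the pairs of classes whose marks have to agree.\<close>

definition weight :: "(nat \<Rightarrow> nat) \<Rightarrow> (cell \<Rightarrow> nat) \<Rightarrow> real" where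
  "weight k c = (\<Prod>e\<in>slots k \<times> slots k. g (c e)) *
     2 powi beta (cell_graph {e \<in> slots k \<times> slots k. c e \<ge> 2})"

text \<open>The function g drops one factor 2 for x >= 2 (at x = 2 this reads 2^0 = 1). These
  factors, one for each edge of the overlap graph, become the term |E| in
  \<open>beta\<close>.\<close>

lemma power_choose_2: "2 ^ (x choose 2) = g x * (if x \<ge> 2 then 2 else 1)"
proof (cases "x \<ge> 2")
  case True
  then have "x choose 2 > 0"
    by (simp add: zero_less_binomial_iff)
  then have "(2::real) ^ (x choose 2) = 2 ^ ((x choose 2) - 1) * 2"
    by (metis Suc_pred' power_Suc2)
  moreover have "g x = 2 ^ ((x choose 2) - 1)"
    using True by (cases "x = 2") (simp_all add: g_def)
  ultimately show ?thesis
    using True by simp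
next
  case False
  then show ?thesis
    by (simp add: g_def binomial_eq_0)
qed

lemma inj_cell_edge: "inj_on (\<lambda>(a, b). {Inl a, Inr b}) S"
  by (auto simp: inj_on_def doubleton_eq_iff)

text \<open>The sum type keeps equal classes of the two labelings apart, so a product of mark counts
  is again a mark count and both moments follow from one expectation formula.\<close>

lemma mark_count_Plus:
  "mark_count G I C * mark_count G J D = mark_count G (I <+> J) (case_sum C D)"
proof -
  let ?A = "{\<sigma> \<in> I \<rightarrow>\<^sub>E UNIV. \<forall>i\<in>I. mark_ok G (\<sigma> i) (C i)}"
  let ?B = "{\<sigma> \<in> J \<rightarrow>\<^sub>E UNIV. \<forall>i\<in>J. mark_ok G (\<sigma> i) (D i)}"
  let ?R = "{\<sigma> \<in> I <+> J \<rightarrow>\<^sub>E UNIV. \<forall>i\<in>I <+> J. mark_ok G (\<sigma> i) (case_sum C D i)}"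
  have "bij_betw (\<lambda>(\<sigma>, \<tau>). \<lambda>i\<in>I <+> J. case_sum \<sigma> \<tau> i) (?A \<times> ?B) ?R"
  proof (rule bij_betwI[where g = "\<lambda>\<rho>. (\<lambda>i\<in>I. \<rho> (Inl i), \<lambda>i\<in>J. \<rho> (Inr i))"])
    show "(\<lambda>(\<sigma>, \<tau>). \<lambda>i\<in>I <+> J. case_sum \<sigma> \<tau> i) \<in> ?A \<times> ?B \<rightarrow> ?R"
      by auto
    show "(\<lambda>\<rho>. (\<lambda>i\<in>I. \<rho> (Inl i), \<lambda>i\<in>J. \<rho> (Inr i))) \<in> ?R \<rightarrow> ?A \<times> ?B"
    proof
      fix \<rho> assume "\<rho> \<in> ?R"
      then have ok: "\<forall>i\<in>I <+> J. mark_ok G (\<rho> i) (case_sum C D i)"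
        by simp
      have "mark_ok G (\<rho> (Inl i)) (C i)" if "i \<in> I" for i
        using bspec[OF ok InlI[OF that]] by simp
      moreover have "mark_ok G (\<rho> (Inr i)) (D i)" if "i \<in> J" for i
        using bspec[OF ok InrI[OF that]] by simp
      ultimately show "(\<lambda>i\<in>I. \<rho> (Inl i), \<lambda>i\<in>J. \<rho> (Inr i)) \<in> ?A \<times> ?B"
        by simp
    qed
    show "(\<lambda>\<rho>. (\<lambda>i\<in>I. \<rho> (Inl i), \<lambda>i\<in>J. \<rho> (Inr i))) ((\<lambda>(\<sigma>, \<tau>). \<lambda>i\<in>I <+> J. case_sum \<sigma> \<tau> i) z) = z"
      if z: "z \<in> ?A \<times> ?B" for z
    proof -
      obtain \<sigma> \<tau> where z_eq: "z = (\<sigma>, \<tau>)" and \<sigma>: "\<sigma> \<in> I \<rightarrow>\<^sub>E UNIV" and \<tau>: "\<tau> \<in> J \<rightarrow>\<^sub>E UNIV"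
        using z by blast
      have "(\<lambda>i\<in>I. (\<lambda>i\<in>I <+> J. case_sum \<sigma> \<tau> i) (Inl i)) = \<sigma>"
        by (rule PiE_ext[OF _ \<sigma>]) (simp_all add: InlI)
      moreover have "(\<lambda>i\<in>J. (\<lambda>i\<in>I <+> J. case_sum \<sigma> \<tau> i) (Inr i)) = \<tau>"
        by (rule PiE_ext[OF _ \<tau>]) (simp_all add: InrI)
      ultimately show ?thesis
        unfolding z_eq by (simp only: prod.case)
    qed
    show "(\<lambda>(\<sigma>, \<tau>). \<lambda>i\<in>I <+> J. case_sum \<sigma> \<tau> i) (\<lambda>i\<in>I. \<rho> (Inl i), \<lambda>i\<in>J. \<rho> (Inr i)) = \<rho>"
      if "\<rho> \<in> ?R" for \<rho>
    proof
      fix i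
      have "\<rho> \<in> I <+> J \<rightarrow>\<^sub>E UNIV"
        using that by simp
      then have "i \<notin> I <+> J \<Longrightarrow> \<rho> i = undefined"
        by (rule PiE_arb)
      then show "(\<lambda>(\<sigma>, \<tau>). \<lambda>i\<in>I <+> J. case_sum \<sigma> \<tau> i) (\<lambda>i\<in>I. \<rho> (Inl i), \<lambda>i\<in>J. \<rho> (Inr i)) i = \<rho> i"
        by (cases i) auto
    qed
  qed
  from bij_betw_same_card[OF this] show ?thesis
    by (simp add: mark_count_def card_cartesian_product)
qed

section \<open>Expectations for one labeling and for a pair\<close>

context
  fixes n :: nat and k :: "nat \<Rightarrow> nat"
  assumes feasible: "feasible_profile n k"
begin

lemma labeling_block_subset: "\<phi> \<in> labelings n k \<Longrightarrow> a \<in> slots k \<Longrightarrow> \<phi> ` block n a \<subseteq> {1..n}"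
  using labeling_image[OF feasible, of \<phi>] block_subset[of a k n] by blast

lemma card_class_pairs:
  assumes \<phi>: "\<phi> \<in> labelings n k"
  shows "card (\<Union>a\<in>slots k. pairs (\<phi> ` block n a)) = (\<Sum>a\<in>slots k. slot_size n a choose 2)"
proof -
  have "card (\<Union>a\<in>slots k. pairs (\<phi> ` block n a)) = (\<Sum>a\<in>slots k. card (pairs (\<phi> ` block n a)))"
  proof (rule card_UN_disjoint)
    show "\<forall>a\<in>slots k. \<forall>b\<in>slots k. a \<noteq> b \<longrightarrow> pairs (\<phi> ` block n a) \<inter> pairs (\<phi> ` block n b) = {}"
      using labeling_blocks_disjoint[OF feasible \<phi>] by (simp add: pairs_Int pairs_eq_empty_iff)
  qed (simp_all add: finite_slots finite_pairs)
  also have "\<dots> = (\<Sum>a\<in>slots k. slot_size n a choose 2)"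
    using card_labeling_block[OF feasible \<phi>] by (intro sum.cong refl) (simp add: card_pairs)
  finally show ?thesis .
qed

text \<open>Classes of one labeling are disjoint, so the constraint graph has no edges: every class
  is isolated and its mark is free.\<close>

lemma expectation_single:
  assumes \<phi>: "\<phi> \<in> labelings n k"
  shows "measure_pmf.expectation (random_graph n)
       (\<lambda>G. real (mark_count G (slots k) (\<lambda>a. \<phi> ` block n a))) =
     2 ^ card (slots k) * (1 / 2) ^ (\<Sum>a\<in>slots k. slot_size n a choose 2)"
proof -
  have "{} = {{a, b} | a b. a \<in> slots k \<and> b \<in> slots k \<and> a \<noteq> b \<and> card (\<phi> ` block n a \<inter> \<phi> ` block n b) \<ge> 2}"
    using labeling_blocks_disjoint[OF feasible \<phi>] by force
  from expectation_mark_count[OF labeling_block_subset[OF \<phi>] finite_slots this] show ?thesis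
    using card_class_pairs[OF \<phi>] by (simp add: num_components_def quotient_def)
qed

text \<open>A matched pair (x, y) corresponds to the common vertex \<open>\<phi> x\<close>, so the
  cell counts of the induced matching are the overlaps of the classes.\<close>

lemma cell_count_overlap:
  assumes \<phi>: "\<phi> \<in> labelings n k" and \<psi>: "\<psi> \<in> labelings n k" and a: "a \<in> slots k" and b: "b \<in> slots k"
  shows "cell_count {(x, y) \<in> stubs n k \<times> stubs n k. \<phi> x = \<psi> y} (a, b) =
           card (\<phi> ` block n a \<inter> \<psi> ` block n b)"
proof -
  let ?F = "{(x, y) \<in> stubs n k \<times> stubs n k. \<phi> x = \<psi> y}"
  let ?A = "{p \<in> ?F. cell_of p = (a, b)}"
  have A: "?A = {(x, y). x \<in> block n a \<and> y \<in> block n b \<and> \<phi> x = \<psi> y}"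
    using a b by (auto simp: cell_of_def block_def stubs_def)
  have "inj_on (\<lambda>p. \<phi> (fst p)) ?A"
  proof (rule inj_onI)
    fix p q assume p: "p \<in> ?A" and q: "q \<in> ?A" and eq: "\<phi> (fst p) = \<phi> (fst q)"
    then have "\<psi> (snd p) = \<psi> (snd q)"
      by auto
    then show "p = q"
      using p q eq inj_onD[OF labeling_inj[OF feasible \<phi>], of "fst p" "fst q"]
        inj_onD[OF labeling_inj[OF feasible \<psi>], of "snd p" "snd q"]
      by (auto simp: prod_eq_iff)
  qed
  from card_image[OF this] have "cell_count ?F (a, b) = card ((\<lambda>p. \<phi> (fst p)) ` ?A)"
    unfolding cell_count_eq by simp
  also have "(\<lambda>p. \<phi> (fst p)) ` ?A = \<phi> ` block n a \<inter> \<psi> ` block n b"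
    unfolding A by force
  finally show ?thesis .
qed

text \<open>Two distinct classes of the same labeling are disjoint, so a constraint always joins a
  row class to a column class. The constraint graph is therefore bipartite and can be read off from
  the cell counts.\<close>

lemma overlap_edges:
  assumes \<phi>: "\<phi> \<in> labelings n k" and \<psi>: "\<psi> \<in> labelings n k"
  defines "C \<equiv> case_sum (\<lambda>a. \<phi> ` block n a) (\<lambda>b. \<psi> ` block n b)"
    and "F \<equiv> {(x, y) \<in> stubs n k \<times> stubs n k. \<phi> x = \<psi> y}"
  shows "cell_graph (H_res k F) =
    {{i, j} | i j. i \<in> slots k <+> slots k \<and> j \<in> slots k <+> slots k \<and> i \<noteq> j \<and> card (C i \<inter> C j) \<ge> 2}"
    (is "_ = ?E")
proof (intro equalityI subsetI)
  fix e assume "e \<in> cell_graph (H_res k F)"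
  then obtain a b where ab: "a \<in> slots k" "b \<in> slots k" "cell_count F (a, b) \<ge> 2" and e: "e = {Inl a, Inr b}"
    by (auto simp: cell_graph_def H_res_def)
  then have "card (C (Inl a) \<inter> C (Inr b)) \<ge> 2"
    using cell_count_overlap[OF \<phi> \<psi>] by (simp add: C_def F_def)
  with ab e show "e \<in> ?E"
    by blast
next
  fix e assume "e \<in> ?E"
  then obtain i j where ij: "i \<in> slots k <+> slots k" "j \<in> slots k <+> slots k" "i \<noteq> j"
    "card (C i \<inter> C j) \<ge> 2" and e: "e = {i, j}"
    by blast
  have no_Inl: False if "i = Inl a" "j = Inl b" for a b
  proof -
    have "a \<in> slots k" "b \<in> slots k" "a \<noteq> b"
      using ij that by auto
    from labeling_blocks_disjoint[OF feasible \<phi> this] show False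
      using ij(4) by (simp add: that C_def)
  qed
  have no_Inr: False if "i = Inr a" "j = Inr b" for a b
  proof -
    have "a \<in> slots k" "b \<in> slots k" "a \<noteq> b"
      using ij that by auto
    from labeling_blocks_disjoint[OF feasible \<psi> this] show False
      using ij(4) by (simp add: that C_def)
  qed
  obtain a b where ab: "i = Inl a \<and> j = Inr b \<or> i = Inr b \<and> j = Inl a"
    using no_Inl no_Inr by (cases i; cases j) blast+
  then have "(a, b) \<in> H_res k F"
    using ij cell_count_overlap[OF \<phi> \<psi>, of a b] by (auto simp: C_def F_def H_res_def Int_commute)
  moreover have "e = {Inl a, Inr b}"
    using ab e by auto
  ultimately show "e \<in> cell_graph (H_res k F)"
    by (force simp: cell_graph_def)
qed

text \<open>Inclusion and exclusion for the edges inside row classes and those inside column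
  classes; a common edge lies in exactly one overlap. The additive form avoids subtraction on
  \<open>nat\<close>.\<close>

lemma card_pair_pairs:
  assumes \<phi>: "\<phi> \<in> labelings n k" and \<psi>: "\<psi> \<in> labelings n k"
  defines "F \<equiv> {(x, y) \<in> stubs n k \<times> stubs n k. \<phi> x = \<psi> y}"
  shows "card (\<Union>i\<in>slots k <+> slots k. pairs (case_sum (\<lambda>a. \<phi> ` block n a) (\<lambda>b. \<psi> ` block n b) i)) +
           (\<Sum>e\<in>slots k \<times> slots k. cell_count F e choose 2) =
         2 * (\<Sum>a\<in>slots k. slot_size n a choose 2)"
proof -
  let ?A = "\<Union>a\<in>slots k. pairs (\<phi> ` block n a)" and ?B = "\<Union>b\<in>slots k. pairs (\<psi> ` block n b)"
  let ?D = "\<lambda>e. pairs (\<phi> ` block n (fst e)) \<inter> pairs (\<psi> ` block n (snd e))"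
  have fin: "finite ?A" "finite ?B"
    by (auto simp: finite_slots intro!: finite_pairs)
  have "(\<Union>i\<in>slots k <+> slots k. pairs (case_sum (\<lambda>a. \<phi> ` block n a) (\<lambda>b. \<psi> ` block n b) i)) = ?A \<union> ?B"
    by (auto simp: Plus_def)
  moreover have "card (?A \<inter> ?B) = (\<Sum>e\<in>slots k \<times> slots k. cell_count F e choose 2)"
  proof -
    have "?A \<inter> ?B = (\<Union>e\<in>slots k \<times> slots k. ?D e)"
      by auto
    also have "card \<dots> = (\<Sum>e\<in>slots k \<times> slots k. card (?D e))"
    proof (rule card_UN_disjoint)
      have disj: "pairs (\<theta> ` block n a) \<inter> pairs (\<theta> ` block n b) = {}"
        if "\<theta> \<in> labelings n k" "a \<in> slots k" "b \<in> slots k" "a \<noteq> b" for \<theta> a b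
        using labeling_blocks_disjoint[OF feasible that] by (simp add: pairs_Int pairs_eq_empty_iff)
      show "\<forall>e\<in>slots k \<times> slots k. \<forall>f\<in>slots k \<times> slots k. e \<noteq> f \<longrightarrow> ?D e \<inter> ?D f = {}"
      proof (intro ballI impI)
        fix e f assume ef: "e \<in> slots k \<times> slots k" "f \<in> slots k \<times> slots k" "e \<noteq> f"
        then consider "fst e \<noteq> fst f" | "snd e \<noteq> snd f"
          by (auto simp: prod_eq_iff)
        then show "?D e \<inter> ?D f = {}"
        proof cases
          case 1
          have "fst e \<in> slots k" "fst f \<in> slots k"
            using ef by auto
          from disj[OF \<phi> this 1] show ?thesis
            by blast
        next
          case 2
          have "snd e \<in> slots k" "snd f \<in> slots k"
            using ef by auto
          from disj[OF \<psi> this 2] show ?thesis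
            by blast
        qed
      qed
    qed (simp_all add: finite_slots finite_pairs)
    also have "\<dots> = (\<Sum>e\<in>slots k \<times> slots k. cell_count F e choose 2)"
    proof (rule sum.cong[OF refl])
      fix e assume "e \<in> slots k \<times> slots k"
      then show "card (?D e) = cell_count F e choose 2"
        using cell_count_overlap[OF \<phi> \<psi>, of "fst e" "snd e"]
        by (auto simp: F_def pairs_Int card_pairs)
    qed
    finally show ?thesis .
  qed
  ultimately show ?thesis
    using card_Un_Int[OF fin] card_class_pairs[OF \<phi>] card_class_pairs[OF \<psi>] by simp
qed

text \<open>Overlaps gain a factor 2^R in the probability, and the constraints on marks cost a
  factor 2^(|W|-c), with W the set of non-isolated classes. Taking one factor 2 per edge out of 2^R
  leaves the product of g and the exponent |E|-|W|+c, which is beta.\<close>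

lemma expectation_pair:
  assumes \<phi>: "\<phi> \<in> labelings n k" and \<psi>: "\<psi> \<in> labelings n k"
  shows "measure_pmf.expectation (random_graph n)
       (\<lambda>G. real (mark_count G (slots k) (\<lambda>a. \<phi> ` block n a)) * real (mark_count G (slots k) (\<lambda>b. \<psi> ` block n b))) =
     (2 ^ card (slots k) * (1 / 2) ^ (\<Sum>a\<in>slots k. slot_size n a choose 2))\<^sup>2 *
     weight k (cell_count {(x, y) \<in> stubs n k \<times> stubs n k. \<phi> x = \<psi> y})"
proof -
  define F where "F = {(x, y) \<in> stubs n k \<times> stubs n k. \<phi> x = \<psi> y}"
  define C where "C = case_sum (\<lambda>a. \<phi> ` block n a) (\<lambda>b. \<psi> ` block n b)"
  define T where "T = (\<Sum>a\<in>slots k. slot_size n a choose 2)"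
  define E where "E = cell_graph (H_res k F)"
  define R where "R = (\<Sum>e\<in>slots k \<times> slots k. cell_count F e choose 2)"
  let ?U = "card (\<Union>i\<in>slots k <+> slots k. pairs (C i))"
  let ?W = "card (\<Union>E)" and ?c = "num_components E"
  have C_sub: "C i \<subseteq> {1..n}" if "i \<in> slots k <+> slots k" for i
  proof (cases i)
    case (Inl a)
    then have "a \<in> slots k"
      using that by auto
    then show ?thesis
      by (simp only: C_def Inl sum.case labeling_block_subset[OF \<phi>])
  next
    case (Inr b)
    then have "b \<in> slots k"
      using that by auto
    then show ?thesis
      by (simp only: C_def Inr sum.case labeling_block_subset[OF \<psi>])
  qed
  have fin: "finite (slots k <+> slots k)"
    by (simp add: finite_slots)
  have E_sub: "\<Union>E \<subseteq> slots k <+> slots k"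
    by (auto simp: E_def cell_graph_def H_res_def)
  have U: "?U + R = 2 * T"
    using card_pair_pairs[OF \<phi> \<psi>] by (simp add: C_def F_def R_def T_def)
  have V: "card (slots k <+> slots k - \<Union>E) + ?W = 2 * card (slots k)"
    using card_Diff_subset[OF finite_subset[OF E_sub fin] E_sub] card_mono[OF fin E_sub]
    by (simp add: card_Plus finite_slots)
  have "(2::real) ^ R = (\<Prod>e\<in>slots k \<times> slots k. g (cell_count F e) * (if cell_count F e \<ge> 2 then 2 else 1))"
    unfolding R_def by (simp add: power_sum power_choose_2)
  also have "\<dots> = (\<Prod>e\<in>slots k \<times> slots k. g (cell_count F e)) * 2 ^ card (H_res k F)"
    by (simp add: prod.distrib H_res_def prod.inter_filter[symmetric] finite_slots)
  finally have R: "(2::real) ^ R = (\<Prod>e\<in>slots k \<times> slots k. g (cell_count F e)) * 2 ^ card E"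
    by (simp add: E_def cell_graph_def card_image inj_cell_edge)
  \<comment> \<open>Multiplication by 2^|W| turns the integer exponent \<open>beta\<close> into the
    natural number |E|+c, so that \<open>powi\<close> becomes an ordinary power.\<close>
  have weight: "weight k (cell_count F) * 2 ^ ?W = 2 ^ R * 2 ^ ?c"
  proof -
    have "(2::real) powi beta E * 2 ^ ?W = 2 powi (beta E + int ?W)"
      by (simp add: power_int_add)
    also have "beta E + int ?W = int (card E + ?c)"
      by (simp add: beta_def)
    also have "(2::real) powi \<dots> = 2 ^ card E * 2 ^ ?c"
      by (simp only: power_int_of_nat power_add)
    finally show ?thesis
      by (simp add: weight_def R E_def H_res_def)
  qed
  have "measure_pmf.expectation (random_graph n)
       (\<lambda>G. real (mark_count G (slots k) (\<lambda>a. \<phi> ` block n a)) * real (mark_count G (slots k) (\<lambda>b. \<psi> ` block n b))) =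
     2 ^ (card (slots k <+> slots k - \<Union>E) + ?c) * (1 / 2) ^ ?U"
    unfolding of_nat_mult[symmetric] mark_count_Plus C_def[symmetric]
  proof (rule expectation_mark_count[OF C_sub fin])
    show "E = {{i, j} | i j. i \<in> slots k <+> slots k \<and> j \<in> slots k <+> slots k \<and> i \<noteq> j \<and> card (C i \<inter> C j) \<ge> 2}"
      unfolding E_def F_def C_def by (rule overlap_edges[OF \<phi> \<psi>])
  qed
  also have "\<dots> = (2 ^ card (slots k) * (1 / 2) ^ T)\<^sup>2 * weight k (cell_count F)"
  proof -
    let ?D = "card (slots k <+> slots k - \<Union>E)"
    have sq: "(2 ^ card (slots k) * (1 / 2) ^ T)\<^sup>2 = (2 ^ (?D + ?W) * (1 / 2) ^ (?U + R) :: real)"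
      unfolding U V by (simp add: power_mult_distrib power_mult[symmetric] mult.commute)
    have "(2 ^ (?D + ?c) * (1 / 2) ^ ?U :: real) * 2 ^ ?W =
        2 ^ (?D + ?W) * (1 / 2) ^ (?U + R) * (2 ^ R * 2 ^ ?c)"
      by (simp add: power_add power_one_over field_simps)
    also have "\<dots> = 2 ^ (?D + ?W) * (1 / 2) ^ (?U + R) * weight k (cell_count F) * 2 ^ ?W"
      unfolding weight[symmetric] by simp
    finally show ?thesis
      unfolding sq by simp
  qed
  finally show ?thesis
    by (simp add: F_def T_def)
qed

lemma card_labelings: "card (labelings n k) = fact n"
  using card_bijections[of "stubs n k" "{1..n}"] card_stubs[OF feasible] finite_stubs
  by (simp add: labelings_def)

text \<open>For each fixed \<phi> the second labeling runs through all perfect matchings exactly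
  once, so the inner sum does not depend on \<phi>. The sum over \<phi> gives one factor n!, against
  two in the squared first moment.\<close>

lemma moment_ratio:
  "measure_pmf.expectation (random_graph n) (\<lambda>G. (real (Z_sgn n k G))\<^sup>2) /
     (measure_pmf.expectation (random_graph n) (\<lambda>G. real (Z_sgn n k G)))\<^sup>2 =
   (\<Sum>F\<in>perfect_matchings (stubs n k) (stubs n k). weight k (cell_count F)) / fact n"
proof -
  obtain c where c: "c > 0"
    and Z: "\<And>G. c * Z_sgn n k G = (\<Sum>\<phi>\<in>labelings n k. mark_count G (slots k) (\<lambda>a. \<phi> ` block n a))"
    using Z_sgn_labelings[OF feasible] by blast
  let ?E = "measure_pmf.expectation (random_graph n)"
  let ?L = "labelings n k"
  let ?Y = "\<lambda>\<phi> G. real (mark_count G (slots k) (\<lambda>a. \<phi> ` block n a))"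
  define B :: real where "B = 2 ^ card (slots k) * (1 / 2) ^ (\<Sum>a\<in>slots k. slot_size n a choose 2)"
  define Wsum where "Wsum = (\<Sum>F\<in>perfect_matchings (stubs n k) (stubs n k). weight k (cell_count F))"
  have Z': "real c * real (Z_sgn n k G) = (\<Sum>\<phi>\<in>?L. ?Y \<phi> G)" for G
    unfolding of_nat_mult[symmetric] Z by simp
  have "finite (set_pmf (random_graph n))"
    unfolding random_graph_def set_Pi_pmf[OF finite_all_edges]
    by (intro finite_PiE_dflt finite_all_edges) simp
  then have int: "integrable (measure_pmf (random_graph n)) f" for f :: "(nat set \<Rightarrow> bool) \<Rightarrow> real"
    by (rule integrable_measure_pmf_finite)
  have "real c * ?E (\<lambda>G. real (Z_sgn n k G)) = ?E (\<lambda>G. \<Sum>\<phi>\<in>?L. ?Y \<phi> G)"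
    unfolding Z'[symmetric] by simp
  also have "\<dots> = (\<Sum>\<phi>\<in>?L. B)"
    using expectation_single by (simp add: Bochner_Integration.integral_sum int B_def)
  finally have first: "real c * ?E (\<lambda>G. real (Z_sgn n k G)) = fact n * B"
    by (simp add: card_labelings)
  have "(real c)\<^sup>2 * ?E (\<lambda>G. (real (Z_sgn n k G))\<^sup>2) = ?E (\<lambda>G. \<Sum>\<phi>\<in>?L. \<Sum>\<psi>\<in>?L. ?Y \<phi> G * ?Y \<psi> G)"
    unfolding sum_product[symmetric] Z'[symmetric] by (simp add: power2_eq_square algebra_simps flip: integral_mult_right_zero)
  also have "\<dots> = (\<Sum>\<phi>\<in>?L. \<Sum>\<psi>\<in>?L.
      B\<^sup>2 * weight k (cell_count {(x, y) \<in> stubs n k \<times> stubs n k. \<phi> x = \<psi> y}))"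
    using expectation_pair by (simp add: Bochner_Integration.integral_sum int B_def)
  also have "\<dots> = (\<Sum>\<phi>\<in>?L. B\<^sup>2 * Wsum)"
  proof (rule sum.cong[OF refl])
    fix \<phi> assume "\<phi> \<in> ?L"
    then have "\<phi> \<in> bijections (stubs n k) {1..n}"
      by (simp add: labelings_def)
    from sum.reindex_bij_betw[OF bij_betw_bijections_matchings[OF this, of "stubs n k"],
        of "\<lambda>F. B\<^sup>2 * weight k (cell_count F)"]
    show "(\<Sum>\<psi>\<in>?L. B\<^sup>2 * weight k (cell_count {(x, y) \<in> stubs n k \<times> stubs n k. \<phi> x = \<psi> y})) = B\<^sup>2 * Wsum"
      by (simp add: Wsum_def labelings_def sum_distrib_left)
  qed
  finally have second: "(real c)\<^sup>2 * ?E (\<lambda>G. (real (Z_sgn n k G))\<^sup>2) = fact n * (B\<^sup>2 * Wsum)"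
    by (simp add: card_labelings)
  have "B > 0"
    by (simp add: B_def)
  have "?E (\<lambda>G. (real (Z_sgn n k G))\<^sup>2) / (?E (\<lambda>G. real (Z_sgn n k G)))\<^sup>2 =
      ((real c)\<^sup>2 * ?E (\<lambda>G. (real (Z_sgn n k G))\<^sup>2)) / (real c * ?E (\<lambda>G. real (Z_sgn n k G)))\<^sup>2"
    using c by (simp add: power_mult_distrib)
  also have "\<dots> = Wsum / fact n"
    unfolding first second using \<open>B > 0\<close> by (simp add: power2_eq_square field_simps)
  finally show ?thesis
    by (simp add: Wsum_def)
qed

end

section \<open>The sum over the high skeletons\<close>

text \<open>The counts are restricted to \<open>M\<close> in order to be extensional, as the
  elements of \<open>high_skeletons\<close> are.\<close>

definition skeleton_of :: "nat \<Rightarrow> (nat \<Rightarrow> nat) \<Rightarrow> (stub \<times> stub) set \<Rightarrow> cell set \<times> (cell \<Rightarrow> nat)" where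
  "skeleton_of n k F =
     (let M = {e \<in> slots k \<times> slots k. R0 n < int (cell_count F e)} in (M, restrict (cell_count F) M))"

lemma high_skeletonD:
  assumes "(M, j) \<in> high_skeletons n k"
  shows "M \<subseteq> slots k \<times> slots k"
    and "\<And>e f. e \<in> M \<Longrightarrow> f \<in> M \<Longrightarrow> e \<noteq> f \<Longrightarrow> fst e \<noteq> fst f \<and> snd e \<noteq> snd f"
    and "j \<in> extensional M"
    and "\<And>e. e \<in> M \<Longrightarrow> R0 n < int (j e)"
    and "\<And>e. e \<in> M \<Longrightarrow> j e \<le> slot_size n (fst e)"
    and "\<And>e. e \<in> M \<Longrightarrow> j e \<le> slot_size n (snd e)"
    and "finite M"
proof -
  have mem: "M \<subseteq> slots k \<times> slots k \<and>
      (\<forall>e\<in>M. \<forall>f\<in>M. e \<noteq> f \<longrightarrow> fst e \<noteq> fst f \<and> snd e \<noteq> snd f) \<and>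
      j \<in> (\<Pi>\<^sub>E e\<in>M. {x. R0 n < int x \<and> x \<le> min (slot_size n (fst e)) (slot_size n (snd e))})"
    using assms unfolding high_skeletons_def mem_Collect_eq prod.case .
  then show "M \<subseteq> slots k \<times> slots k" ..
  then show "finite M"
    by (rule finite_subset) (simp add: finite_slots)
  show "fst e \<noteq> fst f \<and> snd e \<noteq> snd f" if "e \<in> M" "f \<in> M" "e \<noteq> f" for e f
    using conjunct1[OF conjunct2[OF mem]] that by blast
  note j = conjunct2[OF conjunct2[OF mem]]
  show "j \<in> extensional M"
    using j by (simp add: PiE_def)
  show "R0 n < int (j e)" "j e \<le> slot_size n (fst e)" "j e \<le> slot_size n (snd e)" if "e \<in> M" for e
    using PiE_mem[OF j that] by simp_all
qed

text \<open>Separates two kinds of conditions: exact counts on \<open>M\<close>, which select the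
  pairs to be split off, and the bound off \<open>M\<close>, which survives as a condition on the
  remaining matching. Conversely, \<open>j\<close> exceeds R_0 on \<open>M\<close>, so no cell of
  \<open>M\<close> is lost.\<close>

lemma skeleton_of_eq_iff:
  assumes "(M, j) \<in> high_skeletons n k"
  shows "skeleton_of n k F = (M, j) \<longleftrightarrow>
    (\<forall>e\<in>M. cell_count F e = j e) \<and> (\<forall>e\<in>slots k \<times> slots k - M. int (cell_count F e) \<le> R0 n)"
proof
  assume *: "skeleton_of n k F = (M, j)"
  then have M: "M = {e \<in> slots k \<times> slots k. R0 n < int (cell_count F e)}"
    and j: "j = restrict (cell_count F) M"
    by (auto simp: skeleton_of_def Let_def)
  have "cell_count F e = j e" if "e \<in> M" for e
    using that by (simp add: j)
  moreover have "int (cell_count F e) \<le> R0 n" if "e \<in> slots k \<times> slots k - M" for e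
    using that unfolding M by (simp add: not_less)
  ultimately show "(\<forall>e\<in>M. cell_count F e = j e) \<and> (\<forall>e\<in>slots k \<times> slots k - M. int (cell_count F e) \<le> R0 n)"
    by blast
next
  assume *: "(\<forall>e\<in>M. cell_count F e = j e) \<and> (\<forall>e\<in>slots k \<times> slots k - M. int (cell_count F e) \<le> R0 n)"
  have "{e \<in> slots k \<times> slots k. R0 n < int (cell_count F e)} = M"
  proof (intro equalityI subsetI)
    fix e assume e: "e \<in> {e \<in> slots k \<times> slots k. R0 n < int (cell_count F e)}"
    show "e \<in> M"
    proof (rule ccontr)
      assume "e \<notin> M"
      then have "int (cell_count F e) \<le> R0 n"
        using * e by blast
      then show False
        using e by simp
    qed
  next
    fix e assume "e \<in> M"
    then show "e \<in> {e \<in> slots k \<times> slots k. R0 n < int (cell_count F e)}"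
      using * high_skeletonD(1)[OF assms] high_skeletonD(4)[OF assms, of e] by auto
  qed
  moreover have "restrict (cell_count F) M = j"
    using * high_skeletonD(3)[OF assms] by (intro extensionalityI[of _ M]) auto
  ultimately show "skeleton_of n k F = (M, j)"
    by (simp add: skeleton_of_def)
qed

text \<open>At most one cell of \<open>M\<close> meets a given slot, so each sum has at most one
  term.\<close>

lemma row_col_sum_le:
  assumes "(M, j) \<in> high_skeletons n k"
  shows "(\<Sum>b | (a, b) \<in> M. j (a, b)) \<le> slot_size n a"
    and "(\<Sum>a | (a, b) \<in> M. j (a, b)) \<le> slot_size n b"
proof -
  show "(\<Sum>b | (a, b) \<in> M. j (a, b)) \<le> slot_size n a"
  proof (cases "\<exists>b. (a, b) \<in> M")
    case True
    then obtain b where b: "(a, b) \<in> M"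
      by blast
    then have "{b. (a, b) \<in> M} = {b}"
      using high_skeletonD(2)[OF assms b] by fastforce
    then show ?thesis
      using high_skeletonD(5)[OF assms b] by simp
  next
    case False
    then have "{b. (a, b) \<in> M} = {}"
      by blast
    then show ?thesis
      by (simp only: sum.empty le0)
  qed
  show "(\<Sum>a | (a, b) \<in> M. j (a, b)) \<le> slot_size n b"
  proof (cases "\<exists>a. (a, b) \<in> M")
    case True
    then obtain a where a: "(a, b) \<in> M"
      by blast
    then have "{a. (a, b) \<in> M} = {a}"
      using high_skeletonD(2)[OF assms a] by fastforce
    then show ?thesis
      using high_skeletonD(6)[OF assms a] by simp
  next
    case False
    then have "{a. (a, b) \<in> M} = {}"
      by blast
    then show ?thesis
      by (simp only: sum.empty le0)
  qed
qed

lemma finite_row_stubs: "finite (row_stubs n k M j)"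
  and finite_col_stubs: "finite (col_stubs n k M j)"
  by (simp_all add: row_stubs_def col_stubs_def finite_slots)

text \<open>Holds for arbitrary \<open>M\<close> and \<open>j\<close>, since both sides truncate in
  the same way; this provides the slot counts required by
  \<open>sum_matchings_with_skeleton\<close>.\<close>

lemma card_stub_fibres:
  shows "card {x \<in> row_stubs n k M j. fst x = a} =
      card {x \<in> stubs n k. fst x = a} - (\<Sum>b | (a, b) \<in> M. j (a, b))"
    and "card {y \<in> col_stubs n k M j. fst y = b} =
      card {y \<in> stubs n k. fst y = b} - (\<Sum>a | (a, b) \<in> M. j (a, b))"
proof -
  have fib: "card {x \<in> Sigma (slots k) (\<lambda>a. {..<d a}). fst x = a} = (if a \<in> slots k then d a else 0)" for d :: "slot \<Rightarrow> nat" and a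
  proof (cases "a \<in> slots k")
    case True
    then have "{x \<in> Sigma (slots k) (\<lambda>a. {..<d a}). fst x = a} = {a} \<times> {..<d a}"
      by auto
    then show ?thesis
      using True by (simp add: card_cartesian_product_singleton)
  next
    case False
    then have "{x \<in> Sigma (slots k) (\<lambda>a. {..<d a}). fst x = a} = {}"
      by auto
    then show ?thesis
      using False by (simp only: card.empty if_False)
  qed
  show "card {x \<in> row_stubs n k M j. fst x = a} =
      card {x \<in> stubs n k. fst x = a} - (\<Sum>b | (a, b) \<in> M. j (a, b))"
    unfolding row_stubs_def stubs_def fib by (simp add: row_deg_def)
  show "card {y \<in> col_stubs n k M j. fst y = b} =
      card {y \<in> stubs n k. fst y = b} - (\<Sum>a | (a, b) \<in> M. j (a, b))"
    unfolding col_stubs_def stubs_def fib by (simp add: col_deg_def)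
qed

section \<open>Skeletons under the bound U >= 2\<close>

context
  fixes n :: nat and k :: "nat \<Rightarrow> nat"
  assumes feasible: "feasible_profile n k" and cap: "cap_U n \<ge> 2"
begin

text \<open>A cell above the threshold thus holds at least two pairs and is an edge of the overlap
  graph.\<close>

lemma R0_ge_1: "R0 n \<ge> 1"
  using cap by (simp add: R0_def le_floor_iff)

text \<open>No slot is larger than \<alpha>-2 = U, and U/2 < R_0+1 by the floor. Hence one slot
  cannot meet two cells above the threshold, which would need 2(R_0+1) stubs.\<close>

lemma slot_size_le: "a \<in> slots k \<Longrightarrow> int (slot_size n a) < 2 * (R0 n + 1)"
proof -
  assume a: "a \<in> slots k"
  then have "int (slot_size n a) \<le> cap_U n"
    using int_slot_size[OF feasible a] by (auto simp: slots_def cap_U_def)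
  moreover have "real_of_int (cap_U n) / 2 < real_of_int (R0 n) + 1"
    unfolding R0_def by (rule real_of_int_floor_add_one_gt)
  then have "real_of_int (cap_U n) < real_of_int (2 * (R0 n + 1))"
    by simp
  then have "cap_U n < 2 * (R0 n + 1)"
    by (simp only: of_int_less_iff)
  ultimately show ?thesis
    by simp
qed

text \<open>Row by row, and via \<open>prod.swap\<close> column by column, removed pairs and
  residual degrees add up to the slot sizes. Both sides keep n-J stubs, so residual perfect
  matchings exist.\<close>

lemma card_residual_stubs:
  assumes "(M, j) \<in> high_skeletons n k"
  shows "card (row_stubs n k M j) + (\<Sum>e\<in>M. j e) = n"
    and "card (col_stubs n k M j) + (\<Sum>e\<in>M. j e) = n"
proof -
  note HS = high_skeletonD[OF assms]
  have total: "(\<Sum>a\<in>slots k. slot_size n a) = n"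
    using card_stubs[OF feasible] by (simp add: stubs_def finite_slots)
  have fin: "finite {b. (a, b) \<in> M}" "finite {b. (b, a) \<in> M}" for a
    using finite_subset[of "{b. (a, b) \<in> M}" "snd ` M"] finite_subset[of "{b. (b, a) \<in> M}" "fst ` M"] HS(7)
    by force+
  have "M = Sigma (slots k) (\<lambda>a. {b. (a, b) \<in> M})"
    using HS(1) by auto
  then have rows: "(\<Sum>e\<in>M. j e) = (\<Sum>a\<in>slots k. \<Sum>b | (a, b) \<in> M. j (a, b))"
    using sum.Sigma[OF finite_slots, of k "\<lambda>a. {b. (a, b) \<in> M}" "\<lambda>a b. j (a, b)"] fin(1) by simp
  have "card (row_stubs n k M j) + (\<Sum>e\<in>M. j e) =
      (\<Sum>a\<in>slots k. row_deg n M j a + (\<Sum>b | (a, b) \<in> M. j (a, b)))"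
    by (simp add: row_stubs_def finite_slots rows sum.distrib)
  also have "\<dots> = (\<Sum>a\<in>slots k. slot_size n a)"
    using row_col_sum_le(1)[OF assms] by (simp add: row_deg_def)
  finally show "card (row_stubs n k M j) + (\<Sum>e\<in>M. j e) = n"
    using total by simp
  have "bij_betw prod.swap (Sigma (slots k) (\<lambda>b. {a. (a, b) \<in> M})) M"
    using HS(1) by (auto simp: bij_betw_def inj_on_def image_iff)
  then have "(\<Sum>e\<in>M. j e) = (\<Sum>p\<in>Sigma (slots k) (\<lambda>b. {a. (a, b) \<in> M}). j (prod.swap p))"
    by (simp add: sum.reindex_bij_betw)
  then have cols: "(\<Sum>e\<in>M. j e) = (\<Sum>b\<in>slots k. \<Sum>a | (a, b) \<in> M. j (a, b))"
    using sum.Sigma[OF finite_slots, of k "\<lambda>b. {a. (a, b) \<in> M}" "\<lambda>b a. j (a, b)"] fin(2)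
    by (simp add: split_def prod.swap_def)
  have "card (col_stubs n k M j) + (\<Sum>e\<in>M. j e) =
      (\<Sum>b\<in>slots k. col_deg n M j b + (\<Sum>a | (a, b) \<in> M. j (a, b)))"
    by (simp add: col_stubs_def finite_slots cols sum.distrib)
  also have "\<dots> = (\<Sum>b\<in>slots k. slot_size n b)"
    using row_col_sum_le(2)[OF assms] by (simp add: col_deg_def)
  finally show "card (col_stubs n k M j) + (\<Sum>e\<in>M. j e) = n"
    using total by simp
qed

text \<open>Pairs in two cells of one row have distinct row stubs, all in the block of that row;
  similarly for columns.\<close>

lemma cell_counts_le:
  assumes F: "F \<in> perfect_matchings (stubs n k) (stubs n k)" and "e \<noteq> f"
  shows "fst e = fst f \<Longrightarrow> fst e \<in> slots k \<Longrightarrow> cell_count F e + cell_count F f \<le> slot_size n (fst e)"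
    and "snd e = snd f \<Longrightarrow> snd e \<in> slots k \<Longrightarrow> cell_count F e + cell_count F f \<le> slot_size n (snd e)"
proof -
  have F': "F \<subseteq> stubs n k \<times> stubs n k" "inj_on fst F" "inj_on snd F"
    using F unfolding perfect_matchings_iff by blast+
  have "finite F"
    using F'(1) by (rule finite_subset) (simp add: finite_stubs)
  have "cell_count F e + cell_count F f = card ({p \<in> F. cell_of p = e} \<union> {p \<in> F. cell_of p = f})"
    unfolding cell_count_eq using \<open>finite F\<close> \<open>e \<noteq> f\<close> by (intro card_Un_disjoint[symmetric]) auto
  note sum = this
  show "cell_count F e + cell_count F f \<le> slot_size n (fst e)" if "fst e = fst f" "fst e \<in> slots k"
  proof -
    have "cell_count F e + cell_count F f \<le> card (block n (fst e))"
      unfolding sum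
    proof (rule card_inj_on_le[of fst])
      show "fst ` ({p \<in> F. cell_of p = e} \<union> {p \<in> F. cell_of p = f}) \<subseteq> block n (fst e)"
        using F'(1) that by (auto simp: cell_of_def block_def stubs_def)
    qed (use F'(2) in \<open>auto intro: inj_on_subset\<close>)
    then show ?thesis
      by simp
  qed
  show "cell_count F e + cell_count F f \<le> slot_size n (snd e)" if "snd e = snd f" "snd e \<in> slots k"
  proof -
    have "cell_count F e + cell_count F f \<le> card (block n (snd e))"
      unfolding sum
    proof (rule card_inj_on_le[of snd])
      show "snd ` ({p \<in> F. cell_of p = e} \<union> {p \<in> F. cell_of p = f}) \<subseteq> block n (snd e)"
        using F'(1) that by (auto simp: cell_of_def block_def stubs_def)
    qed (use F'(3) in \<open>auto intro: inj_on_subset\<close>)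
    then show ?thesis
      by simp
  qed
qed

lemma cell_count_le:
  assumes F: "F \<in> perfect_matchings (stubs n k) (stubs n k)" and e: "e \<in> slots k \<times> slots k"
  shows "cell_count F e \<le> slot_size n (fst e)" "cell_count F e \<le> slot_size n (snd e)"
proof -
  \<comment> \<open>The second cell is a dummy, shifted to differ from \<open>e\<close> within the
    same row; its column may fail to be an actual slot.\<close>
  have "cell_count F e \<le> cell_count F e + cell_count F (fst e, (Suc (fst (snd e)), snd (snd e)))"
    by simp
  also have "\<dots> \<le> slot_size n (fst e)"
    using e by (intro cell_counts_le(1)[OF F]) (auto simp: prod_eq_iff)
  finally show "cell_count F e \<le> slot_size n (fst e)" .
  have "cell_count F e \<le> cell_count F e + cell_count F ((Suc (fst (fst e)), snd (fst e)), snd e)"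
    by simp
  also have "\<dots> \<le> slot_size n (snd e)"
    using e by (intro cell_counts_le(2)[OF F]) (auto simp: prod_eq_iff)
  finally show "cell_count F e \<le> slot_size n (snd e)" .
qed

lemma skeleton_of_high:
  assumes F: "F \<in> perfect_matchings (stubs n k) (stubs n k)"
  shows "skeleton_of n k F \<in> high_skeletons n k"
proof -
  let ?M = "{e \<in> slots k \<times> slots k. R0 n < int (cell_count F e)}"
  have "fst e \<noteq> fst f \<and> snd e \<noteq> snd f" if "e \<in> ?M" "f \<in> ?M" "e \<noteq> f" for e f
  proof -
    have ef: "fst e \<in> slots k" "snd e \<in> slots k" "R0 n < int (cell_count F e)" "R0 n < int (cell_count F f)"
      using that by auto
    \<comment> \<open>Each of the two cells has at least R_0+1 pairs, so a common slot would
      contradict \<open>slot_size_le\<close>.\<close>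
    show ?thesis
      using cell_counts_le[OF F that(3)] slot_size_le[OF ef(1)] slot_size_le[OF ef(2)] ef by force
  qed
  moreover have "restrict (cell_count F) ?M \<in>
      (\<Pi>\<^sub>E e\<in>?M. {x. R0 n < int x \<and> x \<le> min (slot_size n (fst e)) (slot_size n (snd e))})"
    using cell_count_le[OF F] by (intro PiE_I) auto
  ultimately show ?thesis
    unfolding high_skeletons_def skeleton_of_def Let_def by blast
qed

text \<open>Skeleton cells have multiplicity at least 2, hence all of \<open>M\<close> enters the
  graph. The residual counts vanish on \<open>M\<close> and g(0) = 1, so the product of g splits
  into a skeleton part and a residual part.\<close>

lemma weight_combine:
  assumes HS: "(M, j) \<in> high_skeletons n k" and 0: "\<forall>e\<in>M. cell_count F e = 0"
  shows "weight k (\<lambda>e. if e \<in> M then j e else cell_count F e) =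
    (\<Prod>e\<in>M. g (j e)) *
    ((\<Prod>e\<in>slots k \<times> slots k. g (cell_count F e)) * 2 powi beta (cell_graph (M \<union> H_res k F)))"
proof -
  note HS = high_skeletonD[OF assms(1)]
  let ?c = "\<lambda>e. if e \<in> M then j e else cell_count F e"
  have "{e \<in> slots k \<times> slots k. ?c e \<ge> 2} = M \<union> H_res k F"
  proof (intro equalityI subsetI)
    fix e assume "e \<in> {e \<in> slots k \<times> slots k. ?c e \<ge> 2}"
    then show "e \<in> M \<union> H_res k F"
      by (cases "e \<in> M") (simp_all add: H_res_def)
  next
    fix e assume e: "e \<in> M \<union> H_res k F"
    show "e \<in> {e \<in> slots k \<times> slots k. ?c e \<ge> 2}"
    proof (cases "e \<in> M")
      case True
      then show ?thesis
        using HS(1) HS(4)[OF True] R0_ge_1 by auto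
    next
      case False
      then show ?thesis
        using e by (simp add: H_res_def)
    qed
  qed
  moreover have "(\<Prod>e\<in>slots k \<times> slots k. g (?c e)) =
      (\<Prod>e\<in>M. g (j e)) * (\<Prod>e\<in>slots k \<times> slots k. g (cell_count F e))"
  proof -
    have fin: "finite (slots k \<times> slots k)"
      by (simp add: finite_slots)
    have "(\<Prod>e\<in>M. g (cell_count F e)) = 1"
      using 0 by (intro prod.neutral) (simp add: g_def)
    then have "(\<Prod>e\<in>slots k \<times> slots k. g (cell_count F e)) = (\<Prod>e\<in>slots k \<times> slots k - M. g (cell_count F e))"
      using prod.subset_diff[OF HS(1) fin, of "\<lambda>e. g (cell_count F e)"] by simp
    moreover have "(\<Prod>e\<in>slots k \<times> slots k. g (?c e)) =
        (\<Prod>e\<in>slots k \<times> slots k - M. g (?c e)) * (\<Prod>e\<in>M. g (?c e))"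
      by (rule prod.subset_diff[OF HS(1) fin])
    moreover have "(\<Prod>e\<in>slots k \<times> slots k - M. g (?c e)) = (\<Prod>e\<in>slots k \<times> slots k - M. g (cell_count F e))"
      by (intro prod.cong refl) simp
    ultimately show ?thesis
      by simp
  qed
  ultimately show ?thesis
    by (simp add: weight_def)
qed

lemma card_skeleton_matchings:
  assumes "(M, j) \<in> high_skeletons n k"
  shows "real (card (skeleton_matchings (stubs n k) (stubs n k) M j)) =
    (\<Prod>e\<in>M. falling (slot_size n (fst e)) (j e) * falling (slot_size n (snd e)) (j e)) / (\<Prod>e\<in>M. fact (j e))"
proof -
  note HS = high_skeletonD[OF assms]
  have "card (skeleton_matchings (stubs n k) (stubs n k) M j) =
      card (\<Pi>\<^sub>E e\<in>M. partial_matchings {x \<in> stubs n k. fst x = fst e} {y \<in> stubs n k. fst y = snd e} (j e))"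
    using HS(2) by (intro bij_betw_same_card[OF bij_betw_skeleton_matchings])
  also have "\<dots> = (\<Prod>e\<in>M. card (partial_matchings (block n (fst e)) (block n (snd e)) (j e)))"
    unfolding card_PiE[OF HS(7)]
  proof (rule prod.cong[OF refl])
    fix e assume "e \<in> M"
    then have "fst e \<in> slots k" "snd e \<in> slots k"
      using HS(1) by auto
    then show "card (partial_matchings {x \<in> stubs n k. fst x = fst e} {y \<in> stubs n k. fst y = snd e} (j e)) =
        card (partial_matchings (block n (fst e)) (block n (snd e)) (j e))"
      by (simp only: stubs_fibre)
  qed
  finally show ?thesis
    by (simp add: card_partial_matchings prod_dividef)
qed

text \<open>The number of skeleton matchings supplies the factorials of the cells in
  \<open>w_hi\<close>. The residual sum is (n-J)! times an expectation, and (n-J)! = n!/(n)_J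
  supplies the remaining denominator.\<close>

lemma sum_weight_skeleton:
  assumes HS: "(M, j) \<in> high_skeletons n k"
  shows "(\<Sum>F | F \<in> perfect_matchings (stubs n k) (stubs n k) \<and> skeleton_of n k F = (M, j). weight k (cell_count F)) =
    fact n * (w_hi n M j * A_res n k M j)"
proof -
  let ?X = "stubs n k"
  let ?S = "slots k \<times> slots k"
  let ?R = "perfect_matchings (row_stubs n k M j) (col_stubs n k M j)"
  let ?J = "\<Sum>e\<in>M. j e"
  let ?f = "\<lambda>F. (\<Prod>e\<in>?S. g (cell_count F e)) * 2 powi beta (cell_graph (M \<union> H_res k F)) * indicator (event_E n k M) F"
  \<comment> \<open>The bound off \<open>M\<close> becomes part of the summand, since the splitting
    lemma handles only exact counts on \<open>M\<close>.\<close>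
  define h where "h c = (if \<forall>e\<in>?S - M. int (c e) \<le> R0 n then weight k c else 0)" for c
  note HSD = high_skeletonD[OF HS]
  have finR: "finite ?R"
    by (intro finite_perfect_matchings finite_row_stubs finite_col_stubs)
  have "card (row_stubs n k M j) = n - ?J" "card (col_stubs n k M j) = n - ?J"
    using card_residual_stubs[OF HS] by linarith+
  then have cardR: "card ?R = fact (n - ?J)"
    by (simp add: card_perfect_matchings finite_row_stubs finite_col_stubs)
  \<comment> \<open>\<open>pmf_of_set\<close> is the uniform distribution only for a nonempty finite
    set.\<close>
  then have "?R \<noteq> {}"
    by (metis card.empty fact_nonzero)
  have finP: "finite (perfect_matchings ?X ?X)"
    by (intro finite_perfect_matchings finite_stubs)
  have "(\<Sum>F | F \<in> perfect_matchings ?X ?X \<and> skeleton_of n k F = (M, j). weight k (cell_count F)) =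
      (\<Sum>F | F \<in> perfect_matchings ?X ?X \<and> (\<forall>e\<in>M. cell_count F e = j e). h (cell_count F))"
  proof (rule sum.mono_neutral_cong_left)
    show "finite {F \<in> perfect_matchings ?X ?X. \<forall>e\<in>M. cell_count F e = j e}"
      using finP by simp
  qed (use skeleton_of_eq_iff[OF HS] in \<open>auto simp: h_def\<close>)
  also have "\<dots> = card (skeleton_matchings ?X ?X M j) *
      (\<Sum>F | F \<in> ?R \<and> (\<forall>e\<in>M. cell_count F e = 0). h (\<lambda>e. if e \<in> M then j e else cell_count F e))"
    using finite_stubs finite_row_stubs finite_col_stubs HSD(7)
    by (intro sum_matchings_with_skeleton card_stub_fibres)
  \<comment> \<open>Passing to all residual matchings adds only zero terms, because the event
    excludes pairs in cells of \<open>M\<close>.\<close>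
  also have "(\<Sum>F | F \<in> ?R \<and> (\<forall>e\<in>M. cell_count F e = 0). h (\<lambda>e. if e \<in> M then j e else cell_count F e)) =
      (\<Sum>F\<in>?R. (\<Prod>e\<in>M. g (j e)) * ?f F)"
  proof (rule sum.mono_neutral_cong_left[OF finR])
    have split_cells: "(\<forall>e\<in>S. (e \<in> M \<longrightarrow> A e) \<and> (e \<notin> M \<longrightarrow> B e)) \<longleftrightarrow>
        (\<forall>e\<in>M. A e) \<and> (\<forall>e\<in>S - M. B e)" if "M \<subseteq> S" for S :: "cell set" and A B
      using that by blast
    have E: "F \<in> event_E n k M \<longleftrightarrow>
        (\<forall>e\<in>M. cell_count F e = 0) \<and> (\<forall>e\<in>?S - M. int (cell_count F e) \<le> R0 n)" for F
      unfolding event_E_def mem_Collect_eq by (rule split_cells[OF HSD(1)])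
    show "\<forall>F\<in>?R - {F \<in> ?R. \<forall>e\<in>M. cell_count F e = 0}. (\<Prod>e\<in>M. g (j e)) * ?f F = 0"
      using E by (simp add: indicator_def)
    show "h (\<lambda>e. if e \<in> M then j e else cell_count F e) = (\<Prod>e\<in>M. g (j e)) * ?f F"
      if "F \<in> {F \<in> ?R. \<forall>e\<in>M. cell_count F e = 0}" for F
    proof -
      have 0: "\<forall>e\<in>M. cell_count F e = 0"
        using that by simp
      have "(\<forall>e\<in>?S - M. int (if e \<in> M then j e else cell_count F e) \<le> R0 n) \<longleftrightarrow> F \<in> event_E n k M"
        using 0 unfolding E by simp
      then show ?thesis
        unfolding h_def weight_combine[OF HS 0] by (simp add: indicator_def)
    qed
  qed auto
  also have "\<dots> = (\<Prod>e\<in>M. g (j e)) * (fact (n - ?J) * A_res n k M j)"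
    unfolding A_res_def residual_matching_def integral_pmf_of_set[OF \<open>?R \<noteq> {}\<close> finR] cardR
      sum_distrib_left[symmetric]
    by simp
  finally have "(\<Sum>F | F \<in> perfect_matchings ?X ?X \<and> skeleton_of n k F = (M, j). weight k (cell_count F)) =
      (\<Prod>e\<in>M. falling (slot_size n (fst e)) (j e) * falling (slot_size n (snd e)) (j e)) / (\<Prod>e\<in>M. fact (j e)) *
      ((\<Prod>e\<in>M. g (j e)) * (fact (n - ?J) * A_res n k M j))"
    by (simp only: card_skeleton_matchings[OF HS])
  moreover have "?J \<le> n"
    using card_residual_stubs(1)[OF HS] by linarith
  then have "falling n ?J * fact (n - ?J) = fact n"
    by (rule falling_fact)
  moreover from this have "falling n ?J \<noteq> 0"
    using fact_nonzero[of n, where 'a = real] by auto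
  ultimately show ?thesis
    unfolding w_hi_def by (simp add: field_simps flip: \<open>falling n ?J * fact (n - ?J) = fact n\<close>)
qed

end

theorem proposition9p1:
  fixes n :: nat and k :: "nat \<Rightarrow> nat"
  assumes "n \<ge> 2"
    and "feasible_profile n k"
    and "cap_U n \<ge> 2"
  shows "measure_pmf.expectation (random_graph n) (\<lambda>G. (real (Z_sgn n k G))\<^sup>2) /
           (measure_pmf.expectation (random_graph n) (\<lambda>G. real (Z_sgn n k G)))\<^sup>2 =
         (\<Sum>(M, j)\<in>high_skeletons n k. w_hi n M j * A_res n k M j)"
proof -
  let ?P = "perfect_matchings (stubs n k) (stubs n k)"
  \<comment> \<open>Each matching has exactly one canonical skeleton, and that skeleton is feasible,
    so grouping by skeletons neither loses nor repeats a matching.\<close>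
  have "(\<Sum>F\<in>?P. weight k (cell_count F)) =
      (\<Sum>s\<in>high_skeletons n k. \<Sum>F | F \<in> ?P \<and> skeleton_of n k F = s. weight k (cell_count F))"
    using skeleton_of_high[OF assms(2,3)]
    by (intro sum.group[symmetric] finite_perfect_matchings finite_stubs finite_high_skeletons) auto
  also have "\<dots> = (\<Sum>(M, j)\<in>high_skeletons n k. fact n * (w_hi n M j * A_res n k M j))"
    using sum_weight_skeleton[OF assms(2,3)] by (intro sum.cong refl) auto
  also have "\<dots> = fact n * (\<Sum>(M, j)\<in>high_skeletons n k. w_hi n M j * A_res n k M j)"
    by (simp add: sum_distrib_left split_def)
  finally show ?thesis
    unfolding moment_ratio[OF assms(2)] by simp
qed

end
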